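(* As $n\to\infty$, jointly on $\{0,\dots,S+1\}$, $$\Big(\sqrt n(H_{\hat p_n}-H_{p_0}),\ \sqrt n(F_{\hat p_n}-F_{p_0}),\ \sqrt n(\hat p_n-p_0)\Big)\Rightarrow\big(\widehat{\mathbb H},\ \widehat{\mathbb G},\ \hat g\big)$$ (weak convergence).
   Context: Let $\mathbb N=\{0,1,\dots\}$. For a real sequence $p$ and $k\ge1$ let $\Delta p(k)=p(k+1)-2p(k)+p(k-1)$; $p$ is convex if $\Delta p(k)\ge0$ for all $k\ge1$; $\mathcal C$ is the set of convex sequences with $\sum_kp(k)^2<\infty$. A knot of a sequence or finite vector $p$ is an integer $k\ge1$ with $\Delta p(k)>0$. For a sequence $p$ let $F_p(k)=\sum_{j=0}^kp(j)$ ($F_p(-1)=0$) and $H_p(z)=\sum_{k=0}^{z-1}F_p(k)$ ($H_p(0)=0$). Let $p_0$ be a convex probability mass function on $\mathbb N$ with support $\{0,\dots,S\}$, $S\ge1$. Let $X_1,X_2,\dots$ be i.i.d. with pmf $p_0$, $p_n(j)=\frac1n\sum_{i\le n}\mathbb 1\{X_i=j\}$, and let the least squares estimator $\hat p_n$ be the unique minimizer over $\mathcal C$ of $\frac12\sum_{j}(p_n(j)-p(j))^2$. Let $\mathbb U$ be a standard Brownian bridge on $[0,1]$, $\mathbb W(k)=\mathbb U(F_{p_0}(k))-\mathbb U(F_{p_0}(k-1))$ for $k\in\{0,\dots,S+1\}$. Let $s_1<\dots<s_m$ be the knots of $p_0$ in $\{1,\dots,S\}$ (possibly $m=0$), $s_0=0$,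 $s_{m+1}=S+1$, $\mathcal K=\{s_1,\dots,s_m\}$. A vector $g=(g(0),\dots,g(S+1))$ is convex on $\{a,\dots,b\}$ if $g(k+1)-2g(k)+g(k-1)\ge0$ for $a<k<b$; $\mathcal C(\mathcal K)$ is the set of $g\in\mathbb R^{S+2}$ convex on $\{s_j,\dots,s_{j+1}\}$ for all $j=0,\dots,m$. Let $\hat g$ be the unique minimizer over $\mathcal C(\mathcal K)$ of $\Phi(g)=\frac12\sum_{k=0}^{S+1}(g(k)-\mathbb W(k))^2$, and set $\widehat{\mathbb H}(0)=0$, $\widehat{\mathbb H}(x)=\sum_{k=0}^{x-1}\sum_{j=0}^k\hat g(j)$ for $x\ge1$, and $\widehat{\mathbb G}(x)=\sum_{k=0}^x\hat g(k)=\widehat{\mathbb H}(x+1)-\widehat{\mathbb H}(x)$ for $x\in\{0,\dots,S+1\}$. *)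

theory Defs
  imports "HOL-Probability.Probability"
begin

definition Delta :: "(nat \<Rightarrow> real) \<Rightarrow> nat \<Rightarrow> real" where
  "Delta p k = p (k + 1) - 2 * p k + p (k - 1)"

definition convex_seq :: "(nat \<Rightarrow> real) \<Rightarrow> bool" where
  "convex_seq p \<longleftrightarrow> (\<forall>k\<ge>1. Delta p k \<ge> 0)"

definition convex_L2 :: "(nat \<Rightarrow> real) set" where
  "convex_L2 = {p. convex_seq p \<and> summable (\<lambda>k. (p k)\<^sup>2)}"

definition is_knot :: "(nat \<Rightarrow> real) \<Rightarrow> nat \<Rightarrow> bool" where
  "is_knot p k \<longleftrightarrow> k \<ge> 1 \<and> Delta p k > 0"

definition cdfF :: "(nat \<Rightarrow> real) \<Rightarrow> nat \<Rightarrow> real" where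
  "cdfF p k = (\<Sum>j\<le>k. p j)"

definition cdfH :: "(nat \<Rightarrow> real) \<Rightarrow> nat \<Rightarrow> real" where
  "cdfH p z = (\<Sum>k<z. cdfF p k)"

definition emp_pmf :: "(nat \<Rightarrow> 'a \<Rightarrow> nat) \<Rightarrow> nat \<Rightarrow> 'a \<Rightarrow> nat \<Rightarrow> real" where
  "emp_pmf X n \<omega> j = real (card {i. i < n \<and> X i \<omega> = j}) / real n"

definition lsq_crit :: "(nat \<Rightarrow> real) \<Rightarrow> (nat \<Rightarrow> real) \<Rightarrow> real" where
  "lsq_crit q p = (1/2) * (\<Sum>j. (q j - p j)\<^sup>2)"

definition lse :: "(nat \<Rightarrow> real) \<Rightarrow> (nat \<Rightarrow> real)" where
  "lse q = (THE p. p \<in> convex_L2 \<and> (\<forall>p'\<in>convex_L2. lsq_crit q p \<le> lsq_crit q p'))"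

definition convex_pmf_support :: "(nat \<Rightarrow> real) \<Rightarrow> nat \<Rightarrow> bool" where
  "convex_pmf_support p0 S \<longleftrightarrow>
     S \<ge> 1 \<and> convex_seq p0 \<and> (\<forall>k\<le>S. p0 k > 0) \<and> (\<forall>k>S. p0 k = 0) \<and>
     (\<Sum>k\<le>S. p0 k) = 1"

text \<open>A standard Brownian bridge on the probability space N: a process on [0,1] with
  continuous paths which is a centred Gaussian process with covariance
  min s t - s t, i.e. every finite linear combination of its values is normally distributed
  (degenerate normal = almost surely 0 when the variance vanishes).\<close>
definition brownian_bridge :: "'b measure \<Rightarrow> ('b \<Rightarrow> real \<Rightarrow> real) \<Rightarrow> bool" where
  "brownian_bridge N U \<longleftrightarrow>
     prob_space N \<and>
     (\<forall>t\<in>{0..1}. (\<lambda>\<omega>. U \<omega> t) \<in> borel_measurable N) \<and>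
     (\<forall>\<omega>\<in>space N. continuous_on {0..1} (U \<omega>)) \<and>
     (\<forall>(m::nat) (ts::nat \<Rightarrow> real) (cs::nat \<Rightarrow> real).
        (\<forall>i<m. ts i \<in> {0..1}) \<longrightarrow>
        (let v = (\<Sum>i<m. \<Sum>j<m. cs i * cs j * (min (ts i) (ts j) - ts i * ts j));
             Y = (\<lambda>\<omega>. \<Sum>i<m. cs i * U \<omega> (ts i))
         in (v = 0 \<longrightarrow> (AE \<omega> in N. Y \<omega> = 0)) \<and>
            (v > 0 \<longrightarrow> distributed N lborel Y (\<lambda>x. ennreal (normal_density 0 (sqrt v) x)))))"

text \<open>W(k) = U(F(k)) - U(F(k-1)), with F(-1) = 0.\<close>
definition bb_incr :: "(nat \<Rightarrow> real) \<Rightarrow> (real \<Rightarrow> real) \<Rightarrow> nat \<Rightarrow> real" where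
  "bb_incr p0 u k = u (\<Sum>j\<le>k. p0 j) - u (\<Sum>j<k. p0 j)"

definition knots_in :: "(nat \<Rightarrow> real) \<Rightarrow> nat \<Rightarrow> nat set" where
  "knots_in p0 S = {k. k \<in> {1..S} \<and> is_knot p0 k}"

definition breakpoints :: "(nat \<Rightarrow> real) \<Rightarrow> nat \<Rightarrow> nat set" where
  "breakpoints p0 S = {0} \<union> knots_in p0 S \<union> {S + 1}"

definition convex_between :: "(nat \<Rightarrow> real) \<Rightarrow> nat \<Rightarrow> nat \<Rightarrow> bool" where
  "convex_between g a b \<longleftrightarrow> (\<forall>k. a < k \<and> k < b \<longrightarrow> g (k+1) - 2 * g k + g (k-1) \<ge> 0)"

text \<open>C(K): vectors in R^(S+2) (functions on nat vanishing beyond S+1) that are convex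
  between every pair of consecutive breakpoints s_j < s_(j+1).\<close>
definition convex_K :: "(nat \<Rightarrow> real) \<Rightarrow> nat \<Rightarrow> (nat \<Rightarrow> real) set" where
  "convex_K p0 S = {g. (\<forall>k>S+1. g k = 0) \<and>
      (\<forall>a\<in>breakpoints p0 S. \<forall>b\<in>breakpoints p0 S.
          a < b \<and> (\<forall>c\<in>breakpoints p0 S. \<not> (a < c \<and> c < b)) \<longrightarrow> convex_between g a b)}"

definition Phi :: "nat \<Rightarrow> (nat \<Rightarrow> real) \<Rightarrow> (nat \<Rightarrow> real) \<Rightarrow> real" where
  "Phi S w g = (1/2) * (\<Sum>k\<le>S+1. (g k - w k)\<^sup>2)"

definition ghat :: "(nat \<Rightarrow> real) \<Rightarrow> nat \<Rightarrow> (real \<Rightarrow> real) \<Rightarrow> nat \<Rightarrow> real" where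
  "ghat p0 S u = (THE g. g \<in> convex_K p0 S \<and>
       (\<forall>h\<in>convex_K p0 S. Phi S (bb_incr p0 u) g \<le> Phi S (bb_incr p0 u) h))"

definition weak_conv_rv ::
  "'a measure \<Rightarrow> (nat \<Rightarrow> 'a \<Rightarrow> 'c::topological_space) \<Rightarrow> 'b measure \<Rightarrow> ('b \<Rightarrow> 'c) \<Rightarrow> bool" where
  "weak_conv_rv M Z N Z' \<longleftrightarrow>
     (\<forall>f::'c \<Rightarrow> real. continuous_on UNIV f \<and> bounded (range f) \<longrightarrow>
        (\<lambda>n. \<integral>\<omega>. f (Z n \<omega>) \<partial>M) \<longlonglongrightarrow> (\<integral>\<omega>. f (Z' \<omega>) \<partial>N))"

definition restr :: "nat \<Rightarrow> (nat \<Rightarrow> real) \<Rightarrow> nat \<Rightarrow> real" where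
  "restr S f x = (if x \<le> S + 1 then f x else 0)"

end

theory Submission
  imports Defs
begin

text \<open>
  The vectors that are convex between the knots of \<open>p0\<close> form the tangent cone at \<open>p0\<close> of the
  convex sequences, up to the sign constraint at \<open>S + 1\<close>, which the projection satisfies by
  itself. If the empirical pmf is close to \<open>p0\<close>, the constraints at the knots are inactive and
  the least squares estimator is exactly \<open>p0\<close> plus the projection onto this cone of the empirical
  error. The projection is nonexpansive and positively homogeneous, so with probability tending
  to one the scaled estimator is a fixed continuous function of the scaled multinomial vector,
  and the claim follows by the continuous mapping theorem. The multivariate central limit theorem
  comes from the univariate one by the Cramer-Wold device: trigonometric functions of linear forms
  span an algebra to which the Stone-Weierstrass theorem applies on compact boxes.
\<close>

subsection \<open>Projection onto a cone of second-difference constraints\<close>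

text \<open>Continued by zero, \<open>p0\<close> has a further knot at S + 1, because p0 S > 0 while
  all later values vanish. Near \<open>p0\<close>, convexity of p0 + g can therefore fail only at
  positions in {1..S} where the second difference of \<open>p0\<close> is zero, and at S + 2, where
  for g vanishing beyond S + 1 it says g (S + 1) \<ge> 0. This sign is not part of
  \<open>convex_K\<close>. It comes out of the projection because the empirical error is zero at S +
  1.

  The estimator minimises over infinite sequences. The problem becomes finite dimensional because
  the constraints on {1..S} involve only coordinates up to S + 1: every competitor can be cut off
  there, and its discarded tail enters the criterion only as a nonnegative summand.

  Two exceptional events have to be controlled: leaving the box on which the trigonometric
  approximation is good, and leaving the neighbourhood of \<open>p0\<close> in which the estimator
  is a projection. One continuous tail function serves for both. It is a sum of functions of single
  coordinates, so its expectations converge by the univariate limits alone.\<close>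

definition diff_cone :: "nat set \<Rightarrow> nat \<Rightarrow> (nat \<Rightarrow> real) set" where
  "diff_cone A d = {g. (\<forall>k>d. g k = 0) \<and> (\<forall>k\<in>A. 0 \<le> Delta g k)}"

definition dot_upto :: "nat \<Rightarrow> (nat \<Rightarrow> real) \<Rightarrow> (nat \<Rightarrow> real) \<Rightarrow> real" where
  "dot_upto d x y = (\<Sum>k\<le>d. x k * y k)"

definition sqdist_upto :: "nat \<Rightarrow> (nat \<Rightarrow> real) \<Rightarrow> (nat \<Rightarrow> real) \<Rightarrow> real" where
  "sqdist_upto d x y = (\<Sum>k\<le>d. (x k - y k)\<^sup>2)"

definition cone_proj :: "nat set \<Rightarrow> nat \<Rightarrow> (nat \<Rightarrow> real) \<Rightarrow> nat \<Rightarrow> real" where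
  "cone_proj A d v = (THE g. g \<in> diff_cone A d \<and> (\<forall>h\<in>diff_cone A d. sqdist_upto d g v \<le> sqdist_upto d h v))"

lemma sqdist_nonneg: "0 \<le> sqdist_upto d x y"
  by (simp add: sqdist_upto_def sum_nonneg)

lemma coord_le_sqdist:
  assumes "k \<le> d"
  shows "\<bar>x k - y k\<bar> \<le> sqrt (sqdist_upto d x y)"
proof -
  have "(x k - y k)\<^sup>2 \<le> sqdist_upto d x y"
    unfolding sqdist_upto_def using assms by (intro member_le_sum) auto
  then show ?thesis
    using real_sqrt_le_mono by fastforce
qed

lemma sqrt_sqdist_le:
  assumes "\<And>k. k \<le> d \<Longrightarrow> \<bar>x k - y k\<bar> \<le> c" "0 \<le> c"
  shows "sqrt (sqdist_upto d x y) \<le> (real d + 1) * c"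
proof -
  have "sqdist_upto d x y \<le> (\<Sum>k\<le>d. c\<^sup>2)"
    unfolding sqdist_upto_def using assms by (intro sum_mono) (auto simp: abs_le_square_iff[symmetric])
  also have "\<dots> = (real d + 1) * c\<^sup>2" by simp
  also have "\<dots> \<le> ((real d + 1) * c)\<^sup>2"
    using assms(2) by (simp add: power2_eq_square algebra_simps)
  finally show ?thesis using assms(2) by (simp add: real_le_lsqrt)
qed

lemma sqdist_eq_0D:
  assumes "x \<in> diff_cone A d" "y \<in> diff_cone A d" "sqdist_upto d x y \<le> 0"
  shows "x = y"
proof
  fix k
  show "x k = y k"
  proof (cases "k \<le> d")
    case True
    moreover have "sqdist_upto d x y = 0"
      using assms(3) sqdist_nonneg[of d x y] by linarith
    ultimately show ?thesis
      using coord_le_sqdist[of k d x y] by simp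
  next
    case False
    then show ?thesis using assms by (simp add: diff_cone_def)
  qed
qed

lemma sqdist_expand:
  "sqdist_upto d h v = sqdist_upto d g v + 2 * dot_upto d (\<lambda>k. g k - v k) (\<lambda>k. h k - g k) + sqdist_upto d h g"
  unfolding sqdist_upto_def dot_upto_def sum_distrib_left sum.distrib[symmetric]
  by (rule sum.cong) (auto simp: power2_eq_square algebra_simps)

lemma continuous_on_coord [continuous_intros]:
  "continuous_on A (\<lambda>x::nat \<Rightarrow> real. x k)"
  by (rule continuous_on_subset[OF continuous_on_product_coordinates]) simp

lemma closed_diff_cone: "closed (diff_cone A d)"
proof -
  have "closed {g::nat\<Rightarrow>real. k > d \<longrightarrow> g k = 0}" for k
    by (cases "k > d") (auto intro!: closed_Collect_eq continuous_intros)
  moreover have "closed {g. k \<in> A \<longrightarrow> 0 \<le> Delta g k}" for k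
    unfolding Delta_def by (cases "k \<in> A") (auto intro!: closed_Collect_le continuous_intros)
  moreover have "diff_cone A d =
      (\<Inter>k. {g. k > d \<longrightarrow> g k = 0}) \<inter> (\<Inter>k. {g. k \<in> A \<longrightarrow> 0 \<le> Delta g k})"
    by (auto simp: diff_cone_def)
  ultimately show ?thesis by (auto intro!: closed_Int closed_INT)
qed

text \<open>Tychonoff: the coordinates beyond \<open>d\<close> range over the compact set {0}, so
  the box is compact in the product topology of all sequences.\<close>

lemma compact_box: "compact {x::nat \<Rightarrow> real. (\<forall>k\<le>d. \<bar>x k\<bar> \<le> L) \<and> (\<forall>k>d. x k = 0)}"
proof -
  have "compact (PiE UNIV (\<lambda>k. if k \<le> d then {-L..L} else {0::real}))"
    using compactin_PiE[of "\<lambda>_. euclidean" UNIV "\<lambda>k. if k \<le> d then {-L..L} else {0::real}"]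
    by (auto simp: euclidean_product_topology)
  also have "PiE UNIV (\<lambda>k. if k \<le> d then {-L..L} else {0::real}) =
      {x. (\<forall>k\<le>d. \<bar>x k\<bar> \<le> L) \<and> (\<forall>k>d. x k = 0)}"
    by (force simp: PiE_UNIV_domain Pi_def abs_le_iff split: if_splits)
  finally show ?thesis .
qed

lemma zero_in_diff_cone: "(\<lambda>_. 0) \<in> diff_cone A d"
  by (simp add: diff_cone_def Delta_def)

lemma diff_cone_comb:
  assumes "g \<in> diff_cone A d" "h \<in> diff_cone A d" "0 \<le> a" "0 \<le> b"
  shows "(\<lambda>k. a * g k + b * h k) \<in> diff_cone A d"
proof -
  have "Delta (\<lambda>k. a * g k + b * h k) k = a * Delta g k + b * Delta h k" for k
    by (simp add: Delta_def algebra_simps)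
  then show ?thesis using assms by (simp add: diff_cone_def)
qed

text \<open>Coercivity: zero lies in the cone, so points of the cone that are far from zero cannot
  beat it, and the minimum may be sought in a compact box.\<close>

lemma cone_proj_exists: "\<exists>g\<in>diff_cone A d. \<forall>h\<in>diff_cone A d. sqdist_upto d g v \<le> sqdist_upto d h v"
proof -
  \<comment> \<open>\<open>s\<close> is the distance of \<open>v\<close> from zero. A coordinate of
    \<open>h\<close> above 2 * s in absolute value differs from that of \<open>v\<close> by more
    than s, so \<open>h\<close> is no better than zero.\<close>
  define s where "s = sqrt (sqdist_upto d (\<lambda>_. 0) v)"
  define B where "B = {x::nat \<Rightarrow> real. (\<forall>k\<le>d. \<bar>x k\<bar> \<le> 2 * s) \<and> (\<forall>k>d. x k = 0)}"
  have s: "0 \<le> s" by (simp add: s_def sqdist_nonneg)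
  have "compact (diff_cone A d \<inter> B)"
    unfolding B_def by (intro closed_Int_compact closed_diff_cone compact_box)
  moreover have zero: "(\<lambda>_. 0) \<in> diff_cone A d \<inter> B"
    using zero_in_diff_cone s by (simp add: B_def)
  moreover have "continuous_on (diff_cone A d \<inter> B) (\<lambda>g. sqdist_upto d g v)"
    unfolding sqdist_upto_def by (intro continuous_intros)
  ultimately obtain g where g: "g \<in> diff_cone A d \<inter> B"
      and min: "\<And>h. h \<in> diff_cone A d \<inter> B \<Longrightarrow> sqdist_upto d g v \<le> sqdist_upto d h v"
    using continuous_attains_inf[of "diff_cone A d \<inter> B" "\<lambda>g. sqdist_upto d g v"] by auto
  have "sqdist_upto d g v \<le> sqdist_upto d h v" if h: "h \<in> diff_cone A d" for h
  proof (cases "h \<in> B")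
    case True
    then show ?thesis using h min by simp
  next
    case False
    then obtain k where k: "k \<le> d" "2 * s < \<bar>h k\<bar>"
      using h by (auto simp: B_def diff_cone_def not_le)
    have "\<bar>h k - v k\<bar> \<le> sqrt (sqdist_upto d h v)" "\<bar>0 - v k\<bar> \<le> s"
      unfolding s_def using coord_le_sqdist[OF k(1), of h v] coord_le_sqdist[OF k(1), of "\<lambda>_. 0" v] by auto
    then have "s \<le> sqrt (sqdist_upto d h v)" using k by linarith
    then have "sqdist_upto d (\<lambda>_. 0) v \<le> sqdist_upto d h v" by (simp add: s_def)
    then show ?thesis using min[OF zero] by linarith
  qed
  then show ?thesis using g by auto
qed

text \<open>First-order condition: moving from \<open>g\<close> a fraction t towards
  \<open>h\<close> stays in the convex cone and changes the squared distance by t * (2 * I + t * Q),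
  which is negative for small t if I < 0.\<close>

lemma cone_min_variational:
  assumes g: "g \<in> diff_cone A d" and min: "\<forall>h\<in>diff_cone A d. sqdist_upto d g v \<le> sqdist_upto d h v"
    and h: "h \<in> diff_cone A d"
  shows "0 \<le> dot_upto d (\<lambda>k. g k - v k) (\<lambda>k. h k - g k)"
proof (rule ccontr)
  define I where "I = dot_upto d (\<lambda>k. g k - v k) (\<lambda>k. h k - g k)"
  define Q where "Q = sqdist_upto d h g"
  assume "\<not> 0 \<le> dot_upto d (\<lambda>k. g k - v k) (\<lambda>k. h k - g k)"
  then have I: "I < 0" by (simp add: I_def)
  have Q: "0 \<le> Q" by (simp add: Q_def sqdist_nonneg)
  \<comment> \<open>This size gives t * Q < - I, hence 2 * I + t * Q < 0. The summand 1 in the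
    denominator covers Q = 0.\<close>
  define t where "t = min 1 (- I / (Q + 1))"
  have t: "0 < t" "t \<le> 1" using I Q by (auto simp: t_def divide_neg_pos)
  have "t \<le> - I / (Q + 1)" by (simp add: t_def)
  then have "t * (Q + 1) \<le> - I" using Q by (simp add: field_simps)
  then have tQ: "2 * I + t * Q < 0" using t I by (simp add: algebra_simps)
  define h' where "h' = (\<lambda>k. (1 - t) * g k + t * h k)"
  have "h' \<in> diff_cone A d" unfolding h'_def using g h t by (intro diff_cone_comb) auto
  then have "sqdist_upto d g v \<le> sqdist_upto d h' v" using min by blast
  also have "\<dots> = sqdist_upto d g v + 2 * (t * I) + t * (t * Q)"
  proof -
    have "h' k - g k = t * (h k - g k)" for k by (simp add: h'_def algebra_simps)
    then have "dot_upto d (\<lambda>k. g k - v k) (\<lambda>k. h' k - g k) = t * I" "sqdist_upto d h' g = t * (t * Q)"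
      by (simp_all add: dot_upto_def sqdist_upto_def I_def Q_def sum_distrib_left power_mult_distrib
          power2_eq_square mult_ac)
    then show ?thesis using sqdist_expand[of d h' v g] by simp
  qed
  also have "\<dots> = sqdist_upto d g v + t * (2 * I + t * Q)" by (simp add: algebra_simps)
  also have "\<dots> < sqdist_upto d g v" using t tQ by (simp add: mult_pos_neg)
  finally show False by simp
qed

lemma sqdist_ge_variational:
  assumes "0 \<le> dot_upto d (\<lambda>k. g k - v k) (\<lambda>k. h k - g k)"
  shows "sqdist_upto d g v + sqdist_upto d h g \<le> sqdist_upto d h v"
  using assms sqdist_expand[of d h v g] by simp

text \<open>The variational inequality yields a Pythagorean inequality with the extra term
  \<open>sqdist_upto d h g\<close>, which gives minimality and uniqueness at once.\<close>

lemma cone_proj_eqI: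
  assumes "g \<in> diff_cone A d"
    and "\<And>h. h \<in> diff_cone A d \<Longrightarrow> 0 \<le> dot_upto d (\<lambda>k. g k - v k) (\<lambda>k. h k - g k)"
  shows "cone_proj A d v = g"
  unfolding cone_proj_def
proof (rule the_equality)
  show "g \<in> diff_cone A d \<and> (\<forall>h\<in>diff_cone A d. sqdist_upto d g v \<le> sqdist_upto d h v)"
  proof (intro conjI ballI)
    fix h assume "h \<in> diff_cone A d"
    then have "sqdist_upto d g v + sqdist_upto d h g \<le> sqdist_upto d h v"
      using assms(2) by (intro sqdist_ge_variational)
    then show "sqdist_upto d g v \<le> sqdist_upto d h v" using sqdist_nonneg[of d h g] by linarith
  qed fact
  fix h assume h: "h \<in> diff_cone A d \<and> (\<forall>h'\<in>diff_cone A d. sqdist_upto d h v \<le> sqdist_upto d h' v)"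
  then have "sqdist_upto d g v + sqdist_upto d h g \<le> sqdist_upto d h v" "sqdist_upto d h v \<le> sqdist_upto d g v"
    using assms sqdist_ge_variational by blast+
  then show "h = g" using h assms(1) by (intro sqdist_eq_0D) auto
qed

lemma
  shows cone_proj_in_cone: "cone_proj A d v \<in> diff_cone A d"
    and cone_proj_variational: "h \<in> diff_cone A d \<Longrightarrow>
      0 \<le> dot_upto d (\<lambda>k. cone_proj A d v k - v k) (\<lambda>k. h k - cone_proj A d v k)"
proof -
  obtain g where g: "g \<in> diff_cone A d" "\<forall>h\<in>diff_cone A d. sqdist_upto d g v \<le> sqdist_upto d h v"
    using cone_proj_exists by blast
  note var = cone_min_variational[OF g]
  have "cone_proj A d v = g" using g(1) var by (rule cone_proj_eqI)
  then show "cone_proj A d v \<in> diff_cone A d"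
    "h \<in> diff_cone A d \<Longrightarrow> 0 \<le> dot_upto d (\<lambda>k. cone_proj A d v k - v k) (\<lambda>k. h k - cone_proj A d v k)"
    using g(1) var by auto
qed

text \<open>Each projection is tested in the variational inequality of the other; adding the two and
  using a * b \<le> (a^2 + b^2) / 2 gives the bound.\<close>

lemma cone_proj_nonexpansive: "sqdist_upto d (cone_proj A d v) (cone_proj A d w) \<le> sqdist_upto d v w"
proof -
  define g where "g = cone_proj A d v"
  define h where "h = cone_proj A d w"
  have "0 \<le> dot_upto d (\<lambda>k. g k - v k) (\<lambda>k. h k - g k) + dot_upto d (\<lambda>k. h k - w k) (\<lambda>k. g k - h k)"
    unfolding g_def h_def by (intro add_nonneg_nonneg cone_proj_variational cone_proj_in_cone)
  also have "\<dots> = (\<Sum>k\<le>d. (v k - w k) * (g k - h k) - (g k - h k)\<^sup>2)"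
    unfolding dot_upto_def sum.distrib[symmetric]
    by (rule sum.cong) (auto simp: power2_eq_square algebra_simps)
  also have "\<dots> \<le> (\<Sum>k\<le>d. ((v k - w k)\<^sup>2 - (g k - h k)\<^sup>2) / 2)"
  proof (rule sum_mono)
    fix k
    have "0 \<le> ((v k - w k) - (g k - h k))\<^sup>2" by simp
    then show "(v k - w k) * (g k - h k) - (g k - h k)\<^sup>2 \<le> ((v k - w k)\<^sup>2 - (g k - h k)\<^sup>2) / 2"
      by (simp add: power2_eq_square algebra_simps)
  qed
  also have "\<dots> = (sqdist_upto d v w - sqdist_upto d g h) / 2"
    by (simp add: sqdist_upto_def sum_subtractf sum_divide_distrib[symmetric])
  finally show ?thesis by (simp add: g_def h_def)
qed

text \<open>A test vector \<open>h\<close> for the scaled problem is \<open>h / c\<close> for the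
  original one, and a cone contains both. This lets the factor sqrt n pass through the
  projection.\<close>

lemma cone_proj_scale:
  assumes "0 \<le> c"
  shows "cone_proj A d (\<lambda>k. c * v k) = (\<lambda>k. c * cone_proj A d v k)"
proof (rule cone_proj_eqI)
  show "(\<lambda>k. c * cone_proj A d v k) \<in> diff_cone A d"
    using diff_cone_comb[OF cone_proj_in_cone zero_in_diff_cone assms order_refl] by simp
  fix h assume h: "h \<in> diff_cone A d"
  show "0 \<le> dot_upto d (\<lambda>k. c * cone_proj A d v k - c * v k) (\<lambda>k. h k - c * cone_proj A d v k)"
  proof (cases "c = 0")
    case True
    then show ?thesis by (simp add: dot_upto_def)
  next
    case False
    have "(\<lambda>k. h k / c) \<in> diff_cone A d"
      using diff_cone_comb[OF h zero_in_diff_cone, of "1 / c" 0] assms by simp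
    then have "0 \<le> c * (c * dot_upto d (\<lambda>k. cone_proj A d v k - v k) (\<lambda>k. h k / c - cone_proj A d v k))"
      using assms by (intro mult_nonneg_nonneg cone_proj_variational) auto
    also have "\<dots> = dot_upto d (\<lambda>k. c * cone_proj A d v k - c * v k) (\<lambda>k. h k - c * cone_proj A d v k)"
      unfolding dot_upto_def sum_distrib_left
      by (rule sum.cong) (use False in \<open>auto simp: field_simps\<close>)
    finally show ?thesis .
  qed
qed

lemma cone_proj_cong:
  assumes "\<And>k. k \<le> d \<Longrightarrow> v k = w k"
  shows "cone_proj A d v = cone_proj A d w"
proof -
  have "sqdist_upto d g v = sqdist_upto d g w" for g
    unfolding sqdist_upto_def using assms by (intro sum.cong) auto
  then show ?thesis by (simp add: cone_proj_def)
qed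

lemma cone_proj_zero: "cone_proj A d (\<lambda>_. 0) = (\<lambda>_. 0)"
  using cone_proj_scale[of 0] by simp

lemma abs_cone_proj_le:
  assumes "k \<le> d"
  shows "\<bar>cone_proj A d v k\<bar> \<le> sqrt (sqdist_upto d v (\<lambda>_. 0))"
proof -
  have "\<bar>cone_proj A d v k\<bar> \<le> sqrt (sqdist_upto d (cone_proj A d v) (\<lambda>_. 0))"
    using coord_le_sqdist[OF assms, of "cone_proj A d v" "\<lambda>_. 0"] by simp
  also have "\<dots> \<le> sqrt (sqdist_upto d v (\<lambda>_. 0))"
    using cone_proj_nonexpansive[of d A v "\<lambda>_. 0"] by (simp add: cone_proj_zero)
  finally show ?thesis .
qed

text \<open>Raising the last coordinate never violates the constraints, as it enters only the second
  difference at \<open>d - 1\<close>, with a positive sign.\<close>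

lemma cone_proj_last_nonneg:
  assumes "A \<subseteq> {1..<d}" "0 \<le> v d"
  shows "0 \<le> cone_proj A d v d"
proof (rule ccontr)
  define g where "g = cone_proj A d v"
  assume "\<not> 0 \<le> cone_proj A d v d"
  then have neg: "g d < 0" by (simp add: g_def)
  have g: "g \<in> diff_cone A d" by (simp add: g_def cone_proj_in_cone)
  have "Delta g k \<le> Delta (g(d := 0)) k" if "k \<in> A" for k
    using that assms(1) neg by (auto simp: Delta_def)
  then have "g(d := 0) \<in> diff_cone A d"
    using g by (force simp: diff_cone_def)
  then have "0 \<le> dot_upto d (\<lambda>k. g k - v k) (\<lambda>k. (g(d := 0)) k - g k)"
    unfolding g_def by (rule cone_proj_variational)
  also have "\<dots> = (\<Sum>k\<le>d. if k = d then (g d - v d) * (- g d) else 0)"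
    unfolding dot_upto_def by (rule sum.cong) auto
  also have "\<dots> = (g d - v d) * (- g d)" by simp
  finally have "0 \<le> g d - v d" using neg by (simp add: zero_le_mult_iff mult_le_0_iff)
  then show False using neg assms(2) by linarith
qed

text \<open>The distance in the nonexpansiveness bound reads finitely many coordinates, so it is
  continuous for the product topology and tends to zero as w approaches v. Coordinates beyond
  \<open>d\<close> are constantly zero.\<close>

lemma continuous_on_cone_proj: "continuous_on UNIV (cone_proj A d)"
proof (rule continuous_on_coordinatewise_then_product)
  fix k
  show "continuous_on UNIV (\<lambda>v. cone_proj A d v k)"
  proof (cases "k \<le> d")
    case False
    then have "(\<lambda>v. cone_proj A d v k) = (\<lambda>_. 0)"
      using cone_proj_in_cone[of A d] by (auto simp: diff_cone_def)
    then show ?thesis by (simp only: continuous_on_const)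
  next
    case True
    have "isCont (\<lambda>v. cone_proj A d v k) v" for v :: "nat \<Rightarrow> real"
    proof -
      have "continuous_on UNIV (\<lambda>w. sqrt (sqdist_upto d w v))"
        unfolding sqdist_upto_def by (intro continuous_intros)
      then have "isCont (\<lambda>w. sqrt (sqdist_upto d w v)) v"
        by (simp add: continuous_on_eq_continuous_at)
      then have lim: "((\<lambda>w. sqrt (sqdist_upto d w v)) \<longlongrightarrow> 0) (at v)"
        by (simp add: isCont_def sqdist_upto_def)
      have "\<bar>cone_proj A d w k - cone_proj A d v k\<bar> \<le> sqrt (sqdist_upto d w v)" for w
        using coord_le_sqdist[OF True] real_sqrt_le_mono[OF cone_proj_nonexpansive[of d A w v]]
        by (rule order_trans)
      then have "((\<lambda>w. cone_proj A d w k - cone_proj A d v k) \<longlongrightarrow> 0) (at v)"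
        by (intro tendsto_0_le[OF lim, of _ 1]) (auto simp: sqdist_nonneg)
      then show ?thesis by (simp add: isCont_def LIM_zero_iff)
    qed
    then show ?thesis by (simp add: continuous_on_eq_continuous_at)
  qed
qed

subsection \<open>The least squares estimator near the truth\<close>

text \<open>For convex \<open>p0\<close> these are the positions in {1..S} where its second
  difference vanishes, so that a perturbation has to be convex there itself.\<close>

definition nonknots :: "(nat \<Rightarrow> real) \<Rightarrow> nat \<Rightarrow> nat set" where
  "nonknots p0 S = {k\<in>{1..S}. \<not> is_knot p0 k}"

lemma convex_K_eq_diff_cone: "convex_K p0 S = diff_cone (nonknots p0 S) (S + 1)"
proof (intro set_eqI iffI)
  fix g assume g: "g \<in> convex_K p0 S"
  have "0 \<le> Delta g k" if k: "k \<in> nonknots p0 S" for k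
  proof -
    define P where "P = breakpoints p0 S"
    have k1: "1 \<le> k" "k \<le> S" "\<not> is_knot p0 k" using k by (auto simp: nonknots_def)
    have fin: "finite P" by (auto simp: P_def breakpoints_def knots_in_def)
    have P: "0 \<in> P" "S + 1 \<in> P" "k \<notin> P"
      using k1 by (auto simp: P_def breakpoints_def knots_in_def)
    \<comment> \<open>The breakpoints nearest to \<open>k\<close> on either side are consecutive, so
      the condition of \<open>convex_K\<close> applies between them.\<close>
    define a where "a = Max {c\<in>P. c < k}"
    define b where "b = Min {c\<in>P. k < c}"
    have ne: "{c\<in>P. c < k} \<noteq> {}" "{c\<in>P. k < c} \<noteq> {}"
      using P(1,2) k1 by (auto intro: exI[of _ 0] exI[of _ "S + 1"])
    have a: "a \<in> P" "a < k" using Max_in[OF _ ne(1)] fin by (auto simp: a_def)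
    have b: "b \<in> P" "k < b" using Min_in[OF _ ne(2)] fin by (auto simp: b_def)
    have "\<not> (a < c \<and> c < b)" if "c \<in> P" for c
    proof (cases c k rule: linorder_cases)
      case less
      then have "c \<le> a" using that fin by (auto simp: a_def intro: Max_ge)
      then show ?thesis by simp
    next
      case equal
      then show ?thesis using P that by simp
    next
      case greater
      then have "b \<le> c" using that fin by (auto simp: b_def intro: Min_le)
      then show ?thesis by simp
    qed
    then have "convex_between g a b"
      using g a b unfolding convex_K_def P_def by auto
    then show ?thesis using a b by (simp add: convex_between_def Delta_def)
  qed
  then show "g \<in> diff_cone (nonknots p0 S) (S + 1)"
    using g by (auto simp: diff_cone_def convex_K_def)
next
  fix g assume g: "g \<in> diff_cone (nonknots p0 S) (S + 1)"
  have "convex_between g a b" if b: "b \<in> breakpoints p0 S"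
    and gap: "\<forall>c\<in>breakpoints p0 S. \<not> (a < c \<and> c < b)" for a b
    unfolding convex_between_def
  proof (intro allI impI)
    fix k assume k: "a < k \<and> k < b"
    then have "k \<notin> breakpoints p0 S" using gap by blast
    moreover have "b \<le> S + 1" using b by (auto simp: breakpoints_def knots_in_def)
    ultimately have "k \<in> nonknots p0 S"
      using k by (auto simp: nonknots_def breakpoints_def knots_in_def)
    then show "0 \<le> g (k + 1) - 2 * g k + g (k - 1)"
      using g by (auto simp: diff_cone_def Delta_def)
  qed
  then show "g \<in> convex_K p0 S"
    using g by (auto simp: diff_cone_def convex_K_def)
qed

lemma ghat_eq_cone_proj: "ghat p0 S u = cone_proj (nonknots p0 S) (S + 1) (bb_incr p0 u)"
  by (simp add: ghat_def cone_proj_def Phi_def sqdist_upto_def convex_K_eq_diff_cone del: sum.atMost_Suc)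

section \<open>Reduction of the infinite least squares problem to finite dimension\<close>

lemma lsq_crit_split:
  assumes "\<And>k. k > d \<Longrightarrow> q k = 0" "summable (\<lambda>k. (p k)\<^sup>2)"
  shows "lsq_crit q p = (sqdist_upto d p q + (\<Sum>k. (p (k + Suc d))\<^sup>2)) / 2"
proof -
  have eq: "(q (k + Suc d) - p (k + Suc d))\<^sup>2 = (p (k + Suc d))\<^sup>2" for k
    by (simp add: assms(1))
  have "summable (\<lambda>k. (p (k + Suc d))\<^sup>2)"
    using assms(2) by (rule summable_ignore_initial_segment)
  then have "summable (\<lambda>k. (q (k + Suc d) - p (k + Suc d))\<^sup>2)"
    by (simp only: eq)
  then have "summable (\<lambda>k. (q k - p k)\<^sup>2)"
    using summable_iff_shift[of "\<lambda>k. (q k - p k)\<^sup>2" "Suc d"] by simp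
  from suminf_split_initial_segment[OF this, of "Suc d"]
  show ?thesis
    unfolding lsq_crit_def eq sqdist_upto_def lessThan_Suc_atMost by (simp add: power2_commute)
qed

lemma min_knot_jump:
  "\<exists>\<delta>>0. \<forall>k\<in>{1..S+1}. is_knot p k \<longrightarrow> \<delta> \<le> Delta p k"
proof -
  \<comment> \<open>The added 1 keeps the set nonempty when there is no knot in the range.\<close>
  define D where "D = insert 1 (Delta p ` {k\<in>{1..S+1}. is_knot p k})"
  have D: "finite D" "D \<noteq> {}" by (auto simp: D_def)
  have "0 < Min D" using D by (auto simp: D_def is_knot_def)
  moreover have "Min D \<le> Delta p k" if "k \<in> {1..S+1}" "is_knot p k" for k
    using that by (intro Min_le D) (auto simp: D_def)
  ultimately show ?thesis by blast
qed

text \<open>Near \<open>p0\<close> the knots are inactive: a perturbation smaller than a quarter of every positive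
  second difference keeps them convex, so only the constraints of the tangent cone remain.\<close>

lemma lse_eq_cone_proj:
  assumes p0: "convex_pmf_support p0 S"
    and \<delta>: "\<And>k. k \<in> {1..S+1} \<Longrightarrow> is_knot p0 k \<Longrightarrow> \<delta> \<le> Delta p0 k"
    and q: "\<And>k. k > S \<Longrightarrow> q k = 0"
    and near: "4 * sqrt (sqdist_upto (S + 1) q p0) \<le> \<delta>"
  shows "lse q = (\<lambda>k. p0 k + cone_proj (nonknots p0 S) (S + 1) (\<lambda>k. q k - p0 k) k)"
proof -
  define A where "A = nonknots p0 S"
  define d where "d = S + 1"
  define v where "v = (\<lambda>k. q k - p0 k)"
  define g where "g = cone_proj A d v"
  define r where "r = (\<lambda>k. p0 k + g k)"
  have conv: "0 \<le> Delta p0 k" if "1 \<le> k" for k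
    using p0 that by (simp add: convex_pmf_support_def convex_seq_def)
  have p00: "p0 k = 0" if "k > S" for k
    using p0 that by (simp add: convex_pmf_support_def)
  have gT: "g \<in> diff_cone A d" by (simp add: g_def cone_proj_in_cone)
  then have g0: "g k = 0" if "k > d" for k using that by (simp add: diff_cone_def)
  have glast: "0 \<le> g d"
    unfolding g_def by (rule cone_proj_last_nonneg) (auto simp: A_def nonknots_def d_def v_def q p00)
  have gb: "4 * \<bar>g k\<bar> \<le> \<delta>" for k
  proof (cases "k \<le> d")
    case True
    have "sqdist_upto d v (\<lambda>_. 0) = sqdist_upto (S + 1) q p0" by (simp add: sqdist_upto_def v_def d_def)
    then show ?thesis using abs_cone_proj_le[OF True, of A v] near by (simp add: g_def)
  next
    case False
    moreover have "0 \<le> \<delta>"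
      using near sqdist_nonneg[of "S + 1" q p0] real_sqrt_ge_zero by (smt (verit))
    ultimately show ?thesis by (simp add: g0)
  qed
  have Dg: "- \<delta> \<le> Delta g k" for k
    using gb[of "k + 1"] gb[of k] gb[of "k - 1"] unfolding Delta_def by linarith
  have Dr: "Delta r k = Delta p0 k + Delta g k" for k
    by (simp add: Delta_def r_def)
  have "0 \<le> Delta r k" if k: "1 \<le> k" for k
  proof -
    \<comment> \<open>The third alternative is contradictory, since p0 S > 0 makes S + 1 a knot. It
      closes the gap between {1..S}, which \<open>nonknots\<close> covers, and the zero tail of
      \<open>p0\<close>.\<close>
    consider "k \<in> A" | "k \<in> {1..S+1}" "is_knot p0 k" | "k = S + 1" "\<not> is_knot p0 k" | "k > S + 1"
    proof (cases "k \<le> S + 1")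
      case True
      then show ?thesis
        using that k by (cases "is_knot p0 k"; cases "k = S + 1") (simp_all add: A_def nonknots_def)
    next
      case False
      then show ?thesis using that by simp
    qed
    then show ?thesis
    proof cases
      case 1
      then show ?thesis using gT conv[OF k] by (simp add: Dr diff_cone_def)
    next
      case 2
      then show ?thesis using \<delta>[of k] Dg[of k] by (simp add: Dr)
    next
      case 3
      have "0 < p0 S" using p0 by (simp add: convex_pmf_support_def)
      then have "is_knot p0 (S + 1)" by (simp add: is_knot_def Delta_def p00)
      then show ?thesis using 3 by simp
    next
      case 4
      then have "p0 (k + 1) = 0" "p0 k = 0" "p0 (k - 1) = 0" "g k = 0" "g (k + 1) = 0"
        by (auto intro!: p00 g0 simp: d_def)
      \<comment> \<open>For k = S + 2 the second difference of \<open>r\<close> is g d, so the sign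
        of the last coordinate of the projection is decisive; for larger k it is zero.\<close>
      moreover have "0 \<le> g (k - 1)"
        using 4 glast g0[of "k - 1"] by (cases "k - 1 = d") (auto simp: d_def)
      ultimately show ?thesis by (simp add: Delta_def r_def)
    qed
  qed
  then have rconv: "convex_seq r" by (simp add: convex_seq_def)
  have r0: "r k = 0" if "k > d" for k using that by (simp add: r_def g0 p00 d_def)
  have rsum: "summable (\<lambda>k. (r k)\<^sup>2)"
    by (rule summable_finite[of "{..d}"]) (auto simp: r0)
  have rL2: "r \<in> convex_L2" using rconv rsum by (simp add: convex_L2_def)
  have rest0: "q k = 0" if "k > d" for k using that q by (simp add: d_def)
  have crit_r: "lsq_crit q r = sqdist_upto d r q / 2"
    using lsq_crit_split[of d q, OF rest0 rsum] by (simp add: r0)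
  \<comment> \<open>The criterion of any competitor exceeds that of \<open>r\<close> by at least
    half of its squared distance from \<open>r\<close> plus half of its tail. This proves both that
    \<open>r\<close> is a minimiser and that it is the only one.\<close>
  have key: "sqdist_upto d r q + sqdist_upto d p r + (\<Sum>k. (p (k + Suc d))\<^sup>2) \<le> 2 * lsq_crit q p"
    and tail: "0 \<le> (\<Sum>k. (p (k + Suc d))\<^sup>2)"
    and tail0: "(\<Sum>k. (p (k + Suc d))\<^sup>2) \<le> 0 \<Longrightarrow> \<forall>k>d. p k = 0"
    if p: "p \<in> convex_L2" for p
  proof -
    have psum: "summable (\<lambda>k. (p k)\<^sup>2)" and pconv: "convex_seq p"
      using p by (auto simp: convex_L2_def)
    have shift: "summable (\<lambda>k. (p (k + Suc d))\<^sup>2)"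
      using psum by (rule summable_ignore_initial_segment)
    show tl: "0 \<le> (\<Sum>k. (p (k + Suc d))\<^sup>2)" by (rule suminf_nonneg[OF shift]) simp
    show "\<forall>k>d. p k = 0" if "(\<Sum>k. (p (k + Suc d))\<^sup>2) \<le> 0"
    proof -
      have "\<forall>k. (p (k + Suc d))\<^sup>2 = 0"
        using that tl suminf_eq_zero_iff[OF shift] by simp
      then have *: "p (k + Suc d) = 0" for k by simp
      show ?thesis
      proof (intro allI impI)
        fix k assume "d < k"
        then show "p k = 0" using *[of "k - Suc d"] by simp
      qed
    qed
    \<comment> \<open>Cutting off at d = S + 1 is harmless: a constraint at k \<le> S reads only k -
      1, k and k + 1, all at most d.\<close>
    define h where "h = (\<lambda>k. if k \<le> d then p k - p0 k else 0)"
    have "0 \<le> Delta h k" if k: "k \<in> A" for k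
    proof -
      have "1 \<le> k" "k \<le> S" "Delta p0 k \<le> 0"
        using k by (auto simp: A_def nonknots_def is_knot_def)
      moreover from this have "0 \<le> Delta p k" using pconv by (simp add: convex_seq_def)
      ultimately have "k - 1 \<le> S + 1" "Delta p0 k \<le> Delta p k" by auto
      then show ?thesis using \<open>k \<le> S\<close> by (simp add: Delta_def h_def d_def)
    qed
    then have "h \<in> diff_cone A d" by (simp add: diff_cone_def h_def)
    then have "sqdist_upto d g v + sqdist_upto d h g \<le> sqdist_upto d h v"
      unfolding g_def by (intro sqdist_ge_variational cone_proj_variational)
    moreover have "sqdist_upto d g v = sqdist_upto d r q" "sqdist_upto d h g = sqdist_upto d p r" "sqdist_upto d h v = sqdist_upto d p q"
      unfolding sqdist_upto_def r_def v_def h_def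
      by (auto intro!: sum.cong simp: algebra_simps)
    ultimately show "sqdist_upto d r q + sqdist_upto d p r + (\<Sum>k. (p (k + Suc d))\<^sup>2) \<le> 2 * lsq_crit q p"
      using lsq_crit_split[of d q, OF rest0 psum] by simp
  qed
  have "lse q = r"
    unfolding lse_def
  proof (rule the_equality)
    show "r \<in> convex_L2 \<and> (\<forall>p'\<in>convex_L2. lsq_crit q r \<le> lsq_crit q p')"
    proof (intro conjI ballI)
      fix p assume "p \<in> convex_L2"
      then show "lsq_crit q r \<le> lsq_crit q p"
        using key[of p] tail[of p] sqdist_nonneg[of d p r] unfolding crit_r by linarith
    qed fact
    fix p assume p: "p \<in> convex_L2 \<and> (\<forall>p'\<in>convex_L2. lsq_crit q p \<le> lsq_crit q p')"
    then have "lsq_crit q p \<le> sqdist_upto d r q / 2" using rL2 unfolding crit_r[symmetric] by blast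
    then have "sqdist_upto d p r + (\<Sum>k. (p (k + Suc d))\<^sup>2) \<le> 0"
      using key[of p] p by linarith
    then have pr: "sqdist_upto d p r = 0" and p0: "\<forall>k>d. p k = 0"
      using p tail[of p] tail0[of p] sqdist_nonneg[of d p r] by auto
    show "p = r"
    proof
      fix k
      show "p k = r k"
        using coord_le_sqdist[of k d p r] pr p0 r0[of k] by (cases "k \<le> d") auto
    qed
  qed
  then show ?thesis by (simp add: r_def g_def A_def d_def v_def)
qed

subsection \<open>The Cramer-Wold device\<close>

text \<open>Every generator depends on a single linear form, so its expectation converges by a
  univariate limit. The phase \<open>s\<close> also provides the sines, and the product-to-sum
  formula turns the linear span into an algebra.\<close>

inductive_set trig_span :: "nat \<Rightarrow> ((nat \<Rightarrow> real) \<Rightarrow> real) set" for d where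
  cos: "(\<lambda>x. cos (dot_upto d t x + s)) \<in> trig_span d"
| add: "f \<in> trig_span d \<Longrightarrow> g \<in> trig_span d \<Longrightarrow> (\<lambda>x. f x + g x) \<in> trig_span d"
| scale: "f \<in> trig_span d \<Longrightarrow> (\<lambda>x. c * f x) \<in> trig_span d"

lemma trig_const: "(\<lambda>_. c) \<in> trig_span d"
  using trig_span.scale[OF trig_span.cos[of d "\<lambda>_. 0" 0], of c] by (simp add: dot_upto_def)

lemma trig_cos_mult:
  assumes "g \<in> trig_span d"
  shows "(\<lambda>x. cos (dot_upto d t x + s) * g x) \<in> trig_span d"
  using assms
proof induction
  case (cos u r)
  have "cos (dot_upto d t x + s) * cos (dot_upto d u x + r) =
      1/2 * cos (dot_upto d (\<lambda>k. t k - u k) x + (s - r)) + 1/2 * cos (dot_upto d (\<lambda>k. t k + u k) x + (s + r))" for x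
  proof -
    have "dot_upto d (\<lambda>k. t k - u k) x + (s - r) = (dot_upto d t x + s) - (dot_upto d u x + r)"
      "dot_upto d (\<lambda>k. t k + u k) x + (s + r) = (dot_upto d t x + s) + (dot_upto d u x + r)"
      by (simp_all add: dot_upto_def algebra_simps sum.distrib sum_subtractf)
    then show ?thesis
      by (simp only: cos_times_cos[of "dot_upto d t x + s"]) (simp add: field_simps)
  qed
  then have eq: "(\<lambda>x. cos (dot_upto d t x + s) * cos (dot_upto d u x + r)) = (\<lambda>x.
      1/2 * cos (dot_upto d (\<lambda>k. t k - u k) x + (s - r)) + 1/2 * cos (dot_upto d (\<lambda>k. t k + u k) x + (s + r)))"
    by (rule ext)
  show ?case
    unfolding eq by (rule trig_span.add; rule trig_span.scale; rule trig_span.cos)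
next
  case (add f g)
  show ?case using trig_span.add[OF add.IH] by (simp add: distrib_left)
next
  case (scale f c)
  have "(\<lambda>x. cos (dot_upto d t x + s) * (c * f x)) = (\<lambda>x. c * (cos (dot_upto d t x + s) * f x))"
    by (simp only: mult_ac)
  then show ?case using trig_span.scale[OF scale.IH, of c] by simp
qed

lemma trig_mult:
  assumes "f \<in> trig_span d" "g \<in> trig_span d"
  shows "(\<lambda>x. f x * g x) \<in> trig_span d"
  using assms
proof (induction)
  case (cos t s)
  then show ?case by (intro trig_cos_mult)
next
  case (add f h)
  then have "(\<lambda>x. f x * g x + h x * g x) \<in> trig_span d" using trig_span.add by blast
  then show ?case by (simp add: distrib_right)
next
  case (scale f c)
  then have "(\<lambda>x. c * (f x * g x)) \<in> trig_span d" using trig_span.scale by blast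
  then show ?case by (simp add: mult.assoc)
qed

text \<open>An algebra with constants is closed under composition with real polynomials; this is
  what permits clipping an approximant without leaving the span.\<close>

lemma trig_poly:
  fixes p :: "real \<Rightarrow> real"
  assumes "real_polynomial_function p" "T \<in> trig_span d"
  shows "(\<lambda>x. p (T x)) \<in> trig_span d"
  using assms
proof induction
  case (linear f)
  then obtain c where "f = (\<lambda>y. y * c)"
    using real_bounded_linear by blast
  then show ?case using trig_span.scale[OF linear(2), of c] by (simp add: mult.commute)
next
  case (const c)
  show ?case by (rule trig_const)
next
  case (add f g)
  then show ?case by (simp add: trig_span.add)
next
  case (mult f g)
  then show ?case by (simp add: trig_mult)
qed

lemma continuous_on_dot_upto [continuous_intros]: "continuous_on A (dot_upto d t)"
  unfolding dot_upto_def by (intro continuous_intros)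

lemma continuous_on_trig_span:
  assumes "T \<in> trig_span d"
  shows "continuous_on A T"
  using assms by induction (auto intro!: continuous_intros)

text \<open>A global bound confines the values of \<open>T\<close> to one interval, on which a
  single polynomial can imitate truncation for all arguments, inside and outside the box.\<close>

lemma trig_bounded:
  assumes "T \<in> trig_span d"
  shows "\<exists>B. \<forall>x. \<bar>T x\<bar> \<le> B"
  using assms
proof induction
  case (cos t s)
  then show ?case by (intro exI[of _ 1]) auto
next
  case (add f g)
  then obtain B C where "\<forall>x. \<bar>f x\<bar> \<le> B" "\<forall>x. \<bar>g x\<bar> \<le> C" by blast
  then show ?case by (intro exI[of _ "B + C"] allI order_trans[OF abs_triangle_ineq] add_mono) auto
next
  case (scale f c)
  then obtain B where "\<forall>x. \<bar>f x\<bar> \<le> B" by blast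
  then show ?case by (intro exI[of _ "\<bar>c\<bar> * B"]) (auto simp: abs_mult intro: mult_left_mono)
qed

text \<open>Composing with a polynomial that is close to truncation at \<open>\<plusminus>C\<close> keeps the
  approximant bounded by a constant that does not depend on the box.\<close>

lemma trig_approx:
  fixes f :: "(nat \<Rightarrow> real) \<Rightarrow> real"
  assumes f: "continuous_on UNIV f" "\<And>x. \<bar>f x\<bar> \<le> C" and e: "0 < e"
  obtains T where "T \<in> trig_span d" "\<And>x. \<bar>T x\<bar> \<le> C + e"
    "\<And>x. (\<forall>k\<le>d. \<bar>x k\<bar> \<le> L) \<Longrightarrow> (\<forall>k>d. x k = 0) \<Longrightarrow> \<bar>f x - T x\<bar> \<le> e"
proof -
  define K where "K = {x::nat \<Rightarrow> real. (\<forall>k\<le>d. \<bar>x k\<bar> \<le> L) \<and> (\<forall>k>d. x k = 0)}"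
  interpret function_ring_on "trig_span d" K
  proof
    fix x y assume xy: "x \<in> K" "y \<in> K" "x \<noteq> y"
    then obtain k where k: "x k \<noteq> y k" by blast
    with xy have kd: "k \<le> d" by (force simp: K_def)
    \<comment> \<open>With this frequency in coordinate \<open>k\<close> and the phase - a * y k,
      the cosine is -1 at \<open>x\<close> and 1 at \<open>y\<close>, so the points are
      separated.\<close>
    define a where "a = pi / (x k - y k)"
    define t where "t j = (if j = k then a else 0)" for j
    have dot_upto: "dot_upto d t z = a * z k" for z
      using kd by (simp add: dot_upto_def t_def if_distrib[of "\<lambda>c. c * _"] cong: if_cong)
    have "cos (dot_upto d t x + - a * y k) = - 1"
    proof -
      have "dot_upto d t x + - a * y k = a * (x k - y k)" by (simp add: dot_upto algebra_simps)
      also have "\<dots> = pi" using k by (simp add: a_def)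
      finally show ?thesis by simp
    qed
    moreover have "cos (dot_upto d t y + - a * y k) = 1" by (simp add: dot_upto)
    ultimately show "\<exists>f\<in>trig_span d. f x \<noteq> f y"
      using trig_span.cos[of d t "- a * y k"] by (intro bexI) auto
  qed (auto simp: K_def compact_box trig_const intro: continuous_on_trig_span trig_span.add trig_mult)
  have "continuous_on K f" using f(1) continuous_on_subset by blast
  then obtain T where T: "T \<in> trig_span d" "\<forall>x\<in>K. \<bar>f x - T x\<bar> < e / 2"
    using Stone_Weierstrass_basic[of f "e / 2"] e by auto
  obtain B where B: "\<And>x. \<bar>T x\<bar> \<le> B" using trig_bounded[OF T(1)] by blast
  define clip where "clip y = max (- C) (min C y)" for y
  have C: "0 \<le> C" using f(2)[of undefined] by linarith
  obtain p where p: "real_polynomial_function p" "\<And>y. y \<in> {-B..B} \<Longrightarrow> \<bar>clip y - p y\<bar> < e / 2"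
  proof (rule Stone_Weierstrass_real_polynomial_function[of "{-B..B}" clip "e / 2"])
    show "continuous_on {- B..B} clip"
      unfolding clip_def by (intro continuous_intros)
  qed (use e in auto)
  have near: "\<bar>clip (T x) - p (T x)\<bar> < e / 2" for x
    using B[of x] by (intro p(2)) auto
  show ?thesis
  proof
    show "(\<lambda>x. p (T x)) \<in> trig_span d" using p(1) T(1) by (rule trig_poly)
    show "\<bar>p (T x)\<bar> \<le> C + e" for x
      using near[of x] C e unfolding clip_def by linarith
    fix x assume "\<forall>k\<le>d. \<bar>x k\<bar> \<le> L" "\<forall>k>d. x k = 0"
    then have "\<bar>f x - T x\<bar> < e / 2" using T(2) by (auto simp: K_def)
    \<comment> \<open>The value f x already lies between - C and C, so clipping T x cannot move it
      away from f x.\<close>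
    moreover have "\<bar>f x - clip (T x)\<bar> \<le> \<bar>f x - T x\<bar>"
      using f(2)[of x] unfolding clip_def by linarith
    ultimately show "\<bar>f x - p (T x)\<bar> \<le> e" using near[of x] by linarith
  qed
qed

text \<open>A continuous substitute for the indicator of leaving a box: zero inside the box of
  radius L, at least 1 once some coordinate reaches L + 1.\<close>

definition tail_fn :: "nat \<Rightarrow> real \<Rightarrow> (nat \<Rightarrow> real) \<Rightarrow> real" where
  "tail_fn d L x = (\<Sum>k\<le>d. min 1 (max 0 (\<bar>x k\<bar> - L)))"

lemma tail_fn_nonneg: "0 \<le> tail_fn d L x"
  by (simp add: tail_fn_def sum_nonneg)

lemma tail_fn_le: "tail_fn d L x \<le> real d + 1"
proof -
  have "tail_fn d L x \<le> (\<Sum>k\<le>d. 1)" unfolding tail_fn_def by (rule sum_mono) auto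
  then show ?thesis by simp
qed

lemma tail_fn_ge_1:
  assumes "k \<le> d" "L + 1 \<le> \<bar>x k\<bar>"
  shows "1 \<le> tail_fn d L x"
proof -
  have "1 \<le> min 1 (max 0 (\<bar>x k\<bar> - L))" using assms by simp
  also have "\<dots> \<le> tail_fn d L x"
    unfolding tail_fn_def using assms(1) by (intro member_le_sum) auto
  finally show ?thesis .
qed

lemma continuous_on_tail_fn: "continuous_on A (tail_fn d L)"
  unfolding tail_fn_def by (intro continuous_intros)

lemma borel_measurable_continuous_fun:
  fixes f :: "'c::topological_space \<Rightarrow> 'd::topological_space"
  assumes "continuous_on UNIV f" "Z \<in> borel_measurable M"
  shows "(\<lambda>\<omega>. f (Z \<omega>)) \<in> borel_measurable M"
  using assms(2) borel_measurable_continuous_onI[OF assms(1)] by (rule measurable_compose)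

lemma (in prob_space) integrable_bounded:
  fixes f :: "'a \<Rightarrow> real"
  assumes "f \<in> borel_measurable M" "\<And>x. \<bar>f x\<bar> \<le> B"
  shows "integrable M f"
  using assms by (intro integrable_const_bound[of _ B]) auto

text \<open>At each point the tail function is zero for all large L, so dominated convergence
  applies. This is tightness of the limit law.\<close>

lemma tail_fn_expectation_tendsto_0:
  assumes "prob_space N" and Z: "Z \<in> borel_measurable N"
  shows "(\<lambda>L. \<integral>\<omega>. tail_fn d (real L) (Z \<omega>) \<partial>N) \<longlonglongrightarrow> 0"
proof -
  interpret prob_space N by fact
  have "(\<lambda>L. \<integral>\<omega>. tail_fn d (real L) (Z \<omega>) \<partial>N) \<longlonglongrightarrow> (\<integral>\<omega>. 0 \<partial>N)"
  proof (rule integral_dominated_convergence[where w = "\<lambda>_. real d + 1"])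
    show "(\<lambda>\<omega>. tail_fn d (real L) (Z \<omega>)) \<in> borel_measurable N" for L
      using continuous_on_tail_fn Z by (rule borel_measurable_continuous_fun)
    show "AE \<omega> in N. (\<lambda>L. tail_fn d (real L) (Z \<omega>)) \<longlonglongrightarrow> 0"
    proof (rule AE_I2)
      fix \<omega>
      have "eventually (\<lambda>L. min 1 (max 0 (\<bar>Z \<omega> k\<bar> - real L)) = 0) sequentially" for k
      proof -
        have "eventually (\<lambda>L. \<bar>Z \<omega> k\<bar> \<le> real L) sequentially"
          by (rule eventually_ge_at_top[of "nat \<lceil>\<bar>Z \<omega> k\<bar>\<rceil>", THEN eventually_mono]) linarith
        then show ?thesis by eventually_elim auto
      qed
      then have "(\<lambda>L. min 1 (max 0 (\<bar>Z \<omega> k\<bar> - real L))) \<longlonglongrightarrow> 0" for k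
        by (rule tendsto_eventually)
      then show "(\<lambda>L. tail_fn d (real L) (Z \<omega>)) \<longlonglongrightarrow> 0"
        unfolding tail_fn_def by (intro tendsto_null_sum)
    qed
    show "AE x in N. norm (tail_fn d (real L) (Z x)) \<le> real d + 1" for L
      using tail_fn_nonneg tail_fn_le by simp
  qed auto
  then show ?thesis by simp
qed

definition linear_weak_conv ::
  "nat \<Rightarrow> 'a measure \<Rightarrow> (nat \<Rightarrow> 'a \<Rightarrow> nat \<Rightarrow> real) \<Rightarrow> 'b measure \<Rightarrow> ('b \<Rightarrow> nat \<Rightarrow> real) \<Rightarrow> bool" where
  "linear_weak_conv d M Z N Y \<longleftrightarrow>
     (\<forall>t. weak_conv_rv M (\<lambda>n \<omega>. dot_upto d t (Z n \<omega>)) N (\<lambda>\<omega>. dot_upto d t (Y \<omega>)))"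

lemma linear_weak_convD:
  fixes f :: "real \<Rightarrow> real"
  assumes "linear_weak_conv d M Z N Y" "continuous_on UNIV f" "\<And>x. \<bar>f x\<bar> \<le> B"
  shows "(\<lambda>n. \<integral>\<omega>. f (dot_upto d t (Z n \<omega>)) \<partial>M) \<longlonglongrightarrow> (\<integral>\<omega>. f (dot_upto d t (Y \<omega>)) \<partial>N)"
proof -
  have "bounded (range f)" using assms(3) by (intro boundedI[of _ B]) auto
  then show ?thesis
    using assms(1,2) unfolding linear_weak_conv_def weak_conv_rv_def by blast
qed

text \<open>Each summand is a function of one coordinate, that is, of the linear form given by a
  unit vector. Tightness thus passes from the limit to the sequence.\<close>

lemma tail_fn_expectation_tendsto:
  assumes "prob_space M" "prob_space N"
    and Z: "\<And>n. Z n \<in> borel_measurable M"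
    and Y: "Y \<in> borel_measurable N"
    and conv: "linear_weak_conv d M Z N Y"
  shows "(\<lambda>n. \<integral>\<omega>. tail_fn d L (Z n \<omega>) \<partial>M) \<longlonglongrightarrow> (\<integral>\<omega>. tail_fn d L (Y \<omega>) \<partial>N)"
proof -
  interpret M: prob_space M by fact
  interpret N: prob_space N by fact
  define g where "g y = min 1 (max 0 (\<bar>y\<bar> - L))" for y :: real
  have g: "continuous_on UNIV g" unfolding g_def by (intro continuous_intros)
  then have [measurable]: "g \<in> borel_measurable borel" by (rule borel_measurable_continuous_onI)
  have [measurable]: "(\<lambda>\<omega>. Z n \<omega> k) \<in> borel_measurable M" for n k
    using continuous_on_coord Z by (rule borel_measurable_continuous_fun)
  have [measurable]: "(\<lambda>\<omega>. Y \<omega> k) \<in> borel_measurable N" for k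
    using continuous_on_coord Y by (rule borel_measurable_continuous_fun)
  have gb: "\<bar>g y\<bar> \<le> 1" for y by (auto simp: g_def)
  have lim: "(\<lambda>n. \<integral>\<omega>. g (Z n \<omega> k) \<partial>M) \<longlonglongrightarrow> (\<integral>\<omega>. g (Y \<omega> k) \<partial>N)" if "k \<le> d" for k
  proof -
    have "dot_upto d (\<lambda>j. if j = k then 1 else 0) x = x k" for x
      using that by (simp add: dot_upto_def if_distrib[of "\<lambda>c. c * _"] cong: if_cong)
    then show ?thesis
      using linear_weak_convD[OF conv g gb, of "\<lambda>j. if j = k then 1 else 0"] by simp
  qed
  have "(\<integral>\<omega>. tail_fn d L (Z n \<omega>) \<partial>M) = (\<Sum>k\<le>d. \<integral>\<omega>. g (Z n \<omega> k) \<partial>M)" for n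
    unfolding tail_fn_def g_def[symmetric]
    by (rule Bochner_Integration.integral_sum) (rule M.integrable_bounded[OF _ gb], measurable)
  moreover have "(\<integral>\<omega>. tail_fn d L (Y \<omega>) \<partial>N) = (\<Sum>k\<le>d. \<integral>\<omega>. g (Y \<omega> k) \<partial>N)"
    unfolding tail_fn_def g_def[symmetric]
    by (rule Bochner_Integration.integral_sum) (rule N.integrable_bounded[OF _ gb], measurable)
  ultimately show ?thesis using lim by (auto intro!: tendsto_sum)
qed

lemma trig_expectation_tendsto:
  assumes "prob_space M" "prob_space N"
    and Z: "\<And>n. Z n \<in> borel_measurable M"
    and Y: "Y \<in> borel_measurable N"
    and conv: "linear_weak_conv d M Z N Y"
    and T: "T \<in> trig_span d"
  shows "(\<lambda>n. \<integral>\<omega>. T (Z n \<omega>) \<partial>M) \<longlonglongrightarrow> (\<integral>\<omega>. T (Y \<omega>) \<partial>N)"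
proof -
  interpret M: prob_space M by fact
  interpret N: prob_space N by fact
  have int: "integrable M (\<lambda>\<omega>. T (Z n \<omega>))" "integrable N (\<lambda>\<omega>. T (Y \<omega>))" if "T \<in> trig_span d" for T n
  proof -
    obtain B where "\<And>x. \<bar>T x\<bar> \<le> B" using trig_bounded[OF \<open>T \<in> trig_span d\<close>] by blast
    then show "integrable M (\<lambda>\<omega>. T (Z n \<omega>))" "integrable N (\<lambda>\<omega>. T (Y \<omega>))"
      using borel_measurable_continuous_fun[OF continuous_on_trig_span[OF that] Z, of n]
        borel_measurable_continuous_fun[OF continuous_on_trig_span[OF that] Y]
      by (auto intro!: M.integrable_bounded N.integrable_bounded)
  qed
  show ?thesis
    using T
  proof induction
    case (cos t s)
    show ?case
      by (rule linear_weak_convD[OF conv, of "\<lambda>y. cos (y + s)" 1]) (auto intro!: continuous_intros)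
  next
    case (add f g)
    then show ?case by (simp add: int tendsto_add)
  next
    case (scale f c)
    then show ?case by (simp add: tendsto_mult_left)
  qed
qed

text \<open>The test function is replaced by a trigonometric \<open>T\<close>; the error is at most
  e in the box and at most a multiple of the tail function outside, uniformly in n.\<close>

theorem cramer_wold:
  assumes M: "prob_space M" and N: "prob_space N"
    and Z: "\<And>n. Z n \<in> borel_measurable M"
    and Y: "Y \<in> borel_measurable N"
    and Z0: "\<And>n \<omega> k. k > d \<Longrightarrow> Z n \<omega> k = 0"
    and Y0: "\<And>\<omega> k. k > d \<Longrightarrow> Y \<omega> k = 0"
    and conv: "linear_weak_conv d M Z N Y"
  shows "weak_conv_rv M Z N Y"
  unfolding weak_conv_rv_def
proof (intro allI impI)
  interpret M: prob_space M by fact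
  interpret N: prob_space N by fact
  fix f :: "(nat \<Rightarrow> real) \<Rightarrow> real"
  assume "continuous_on UNIV f \<and> bounded (range f)"
  then obtain C where f: "continuous_on UNIV f" and C: "\<And>x. \<bar>f x\<bar> \<le> C"
    by (auto simp: bounded_iff)
  have C0: "0 \<le> C" using C[of undefined] by linarith
  show "(\<lambda>n. \<integral>\<omega>. f (Z n \<omega>) \<partial>M) \<longlonglongrightarrow> (\<integral>\<omega>. f (Y \<omega>) \<partial>N)"
  proof (rule tendstoI)
    fix \<epsilon> :: real assume \<epsilon>: "0 < \<epsilon>"
    \<comment> \<open>The errors add up to less than 5 * e: two for each replacement of
      \<open>f\<close> by \<open>T\<close> and one for the convergence of \<open>T\<close>. The cap
      at 1 makes D = 2 * C + 1 a bound for the difference of \<open>f\<close> and \<open>T\<close>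
      everywhere.\<close>
    define e where "e = min 1 (\<epsilon> / 8)"
    define D where "D = 2 * C + 1"
    have e: "0 < e" "e \<le> 1" "8 * e \<le> \<epsilon>" using \<epsilon> by (auto simp: e_def)
    have D: "0 < D" using C0 by (simp add: D_def)
    have "eventually (\<lambda>L. (\<integral>\<omega>. tail_fn d (real L) (Y \<omega>) \<partial>N) < e / D) sequentially"
      using e D by (intro order_tendstoD(2)[OF tail_fn_expectation_tendsto_0[OF N Y]]) simp
    then obtain L :: nat where L: "(\<integral>\<omega>. tail_fn d L (Y \<omega>) \<partial>N) < e / D"
      using eventually_happens'[OF sequentially_bot] by blast
    obtain T where T: "T \<in> trig_span d" "\<And>x. \<bar>T x\<bar> \<le> C + e"
      and near: "\<And>x. (\<forall>k\<le>d. \<bar>x k\<bar> \<le> real L + 1) \<Longrightarrow> (\<forall>k>d. x k = 0) \<Longrightarrow> \<bar>f x - T x\<bar> \<le> e"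
      using trig_approx[OF f C e(1)] by blast
    have pw: "\<bar>f x - T x\<bar> \<le> e + D * tail_fn d L x" if x0: "\<forall>k>d. x k = 0" for x
    proof (cases "\<forall>k\<le>d. \<bar>x k\<bar> \<le> real L + 1")
      case True
      have "0 \<le> D * tail_fn d L x" using D tail_fn_nonneg[of d L x] by simp
      then show ?thesis using near[OF True x0] by linarith
    next
      case False
      then have "1 \<le> tail_fn d L x" using tail_fn_ge_1[of _ d L x] by force
      then have "D * 1 \<le> D * tail_fn d L x" using D by (intro mult_left_mono) auto
      then show ?thesis using C[of x] T(2)[of x] e by (simp add: D_def)
    qed
    \<comment> \<open>Stated for an arbitrary probability space, because it is applied both on
      \<open>M\<close> and on \<open>N\<close>.\<close>
    have bound: "\<bar>(\<integral>\<omega>. f (V \<omega>) \<partial>P) - (\<integral>\<omega>. T (V \<omega>) \<partial>P)\<bar> \<le> e + D * (\<integral>\<omega>. tail_fn d L (V \<omega>) \<partial>P)"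
      if P: "prob_space P" and V: "V \<in> borel_measurable P"
        and V0: "\<And>\<omega> k. k > d \<Longrightarrow> V \<omega> k = 0"
      for P :: "'x measure" and V :: "'x \<Rightarrow> nat \<Rightarrow> real"
    proof -
      interpret P: prob_space P by fact
      have if': "integrable P (\<lambda>\<omega>. f (V \<omega>))"
        using borel_measurable_continuous_fun[OF f V] C by (rule P.integrable_bounded)
      have iT: "integrable P (\<lambda>\<omega>. T (V \<omega>))"
        using borel_measurable_continuous_fun[OF continuous_on_trig_span[OF T(1)] V] T(2)
        by (rule P.integrable_bounded)
      have it: "integrable P (\<lambda>\<omega>. tail_fn d L (V \<omega>))"
        using borel_measurable_continuous_fun[OF continuous_on_tail_fn V]
        by (rule P.integrable_bounded[of _ "real d + 1"]) (simp add: tail_fn_nonneg tail_fn_le)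
      have "\<bar>(\<integral>\<omega>. f (V \<omega>) \<partial>P) - (\<integral>\<omega>. T (V \<omega>) \<partial>P)\<bar> = \<bar>\<integral>\<omega>. f (V \<omega>) - T (V \<omega>) \<partial>P\<bar>"
        using if' iT by simp
      also have "\<dots> \<le> (\<integral>\<omega>. \<bar>f (V \<omega>) - T (V \<omega>)\<bar> \<partial>P)"
        by (rule integral_abs_bound)
      also have "\<dots> \<le> (\<integral>\<omega>. e + D * tail_fn d L (V \<omega>) \<partial>P)"
        using if' iT it V0 by (intro integral_mono) (auto intro!: pw)
      also have "\<dots> = e + D * (\<integral>\<omega>. tail_fn d L (V \<omega>) \<partial>P)"
        using it by (simp add: P.prob_space)
      finally show ?thesis .
    qed
    have "eventually (\<lambda>n. (\<integral>\<omega>. tail_fn d L (Z n \<omega>) \<partial>M) < e / D) sequentially"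
      using tail_fn_expectation_tendsto[OF M N Z Y conv] L by (rule order_tendstoD)
    moreover have "eventually (\<lambda>n. dist (\<integral>\<omega>. T (Z n \<omega>) \<partial>M) (\<integral>\<omega>. T (Y \<omega>) \<partial>N) < e) sequentially"
      using trig_expectation_tendsto[OF M N Z Y conv T(1)] e(1) by (rule tendstoD)
    ultimately show "eventually (\<lambda>n. dist (\<integral>\<omega>. f (Z n \<omega>) \<partial>M) (\<integral>\<omega>. f (Y \<omega>) \<partial>N) < \<epsilon>) sequentially"
    proof eventually_elim
      case (elim n)
      have "D * (\<integral>\<omega>. tail_fn d L (Z n \<omega>) \<partial>M) < e" "D * (\<integral>\<omega>. tail_fn d L (Y \<omega>) \<partial>N) < e"
        using elim(1) L D by (simp_all add: field_simps)
      then show ?case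
        using bound[OF M Z Z0, of n] bound[OF N Y Y0] elim(2) e by (simp add: dist_real_def)
    qed
  qed
qed

subsection \<open>Central limit theorem for empirical frequencies\<close>

definition scaled_emp :: "(nat \<Rightarrow> real) \<Rightarrow> nat \<Rightarrow> (nat \<Rightarrow> 'a \<Rightarrow> nat) \<Rightarrow> nat \<Rightarrow> 'a \<Rightarrow> nat \<Rightarrow> real" where
  "scaled_emp p0 d X n \<omega> k = (if k \<le> d then sqrt (real n) * (emp_pmf X n \<omega> k - p0 k) else 0)"

definition bridge_vec :: "(nat \<Rightarrow> real) \<Rightarrow> nat \<Rightarrow> (real \<Rightarrow> real) \<Rightarrow> nat \<Rightarrow> real" where
  "bridge_vec p0 d u k = (if k \<le> d then bb_incr p0 u k else 0)"

text \<open>The quadratic form of the covariance matrix diag(p) - p p^T.\<close>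

definition multinomial_var :: "(nat \<Rightarrow> real) \<Rightarrow> nat \<Rightarrow> (nat \<Rightarrow> real) \<Rightarrow> real" where
  "multinomial_var p d t = (\<Sum>k\<le>d. (t k)\<^sup>2 * p k) - (\<Sum>k\<le>d. t k * p k)\<^sup>2"

section \<open>Gaussian increments of the Brownian bridge\<close>

lemma sum_lessThan_add:
  fixes h :: "nat \<Rightarrow> real"
  shows "(\<Sum>i<m + k. h i) = (\<Sum>i<m. h i) + (\<Sum>i<k. h (m + i))"
  by (induction k) auto

text \<open>The mixed difference of min s t is the length of the overlap of two cells of the
  distribution function, which are disjoint for k \<noteq> l; that of s * t factorises into the two
  cell lengths.\<close>

lemma bridge_cov_increment:
  fixes p :: "nat \<Rightarrow> real"
  assumes "\<And>j. 0 \<le> p j"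
  defines "B \<equiv> \<lambda>s t::real. min s t - s * t"
    and "F \<equiv> \<lambda>k. \<Sum>j\<le>k. p j" and "G \<equiv> \<lambda>k. \<Sum>j<k. p j"
  shows "B (F k) (F l) - B (F k) (G l) - B (G k) (F l) + B (G k) (G l)
    = (if k = l then p k else 0) - p k * p l"
proof -
  have F: "F k = G k + p k" for k
    unfolding F_def G_def by (simp add: lessThan_Suc_atMost[symmetric])
  have le: "F k \<le> G l" if "k < l" for k l
    unfolding F_def G_def using that assms(1) by (intro sum_mono2) auto
  have pos: "0 \<le> p k" "0 \<le> p l" using assms(1) by auto
  have prod: "F k * F l - F k * G l - G k * F l + G k * G l = p k * p l"
    by (simp add: F algebra_simps)
  have "min (F k) (F l) - min (F k) (G l) - min (G k) (F l) + min (G k) (G l) = (if k = l then p k else 0)"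
  proof (cases k l rule: linorder_cases)
    case less
    then show ?thesis using le[OF less] pos F[of k] F[of l] by (auto simp: min_def)
  next
    case equal
    then show ?thesis using pos F[of k] by (auto simp: min_def)
  next
    case greater
    then show ?thesis using le[OF greater] pos F[of k] F[of l] by (auto simp: min_def)
  qed
  then show ?thesis using prod unfolding B_def by linarith
qed

lemma bridge_vec_normal:
  assumes bb: "brownian_bridge N U" and p: "\<And>j. 0 \<le> p j" and F1: "\<And>k. (\<Sum>j\<le>k. p j) \<le> 1"
  shows "multinomial_var p d t = 0 \<Longrightarrow> AE \<omega> in N. dot_upto d t (bridge_vec p d (U \<omega>)) = 0"
    and "multinomial_var p d t > 0 \<Longrightarrow> distributed N lborel (\<lambda>\<omega>. dot_upto d t (bridge_vec p d (U \<omega>)))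
      (\<lambda>x. ennreal (normal_density 0 (sqrt (multinomial_var p d t)) x))"
proof -
  define m where "m = Suc d"
  define F where "F k = (\<Sum>j\<le>k. p j)" for k
  define G where "G k = (\<Sum>j<k. p j)" for k
  define B where "B = (\<lambda>s t::real. min s t - s * t)"
  \<comment> \<open>The first m nodes are the right ends of the cells with weights t k, the next m
    the left ends with weights - t k. The linear form in m = d + 1 increments thus becomes a linear
    combination of 2 * m values of \<open>U\<close>.\<close>
  define ts where "ts i = (if i < m then F i else G (i - m))" for i
  define cs where "cs i = (if i < m then t i else - t (i - m))" for i
  have F01: "F k \<in> {0..1}" for k using p F1 by (auto simp: F_def sum_nonneg)
  have GF: "G k \<le> F k" for k unfolding G_def F_def using p by (intro sum_mono2) auto
  have G01: "G k \<in> {0..1}" for k using p GF[of k] F01[of k] by (auto simp: G_def sum_nonneg)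
  have ts01: "ts i \<in> {0..1}" for i using F01 G01 by (simp add: ts_def)
  have split2: "(\<Sum>i<m + m. cs i * h (ts i)) = (\<Sum>k<m. t k * (h (F k) - h (G k)))" for h
    unfolding sum_lessThan_add
    by (simp add: cs_def ts_def sum.distrib[symmetric] algebra_simps)
  have Y: "(\<Sum>i<m + m. cs i * U \<omega> (ts i)) = dot_upto d t (bridge_vec p d (U \<omega>))" for \<omega>
    unfolding split2[of "U \<omega>"]
    unfolding dot_upto_def bridge_vec_def bb_incr_def F_def G_def m_def lessThan_Suc_atMost
    by (rule sum.cong) auto
  have "(\<Sum>i<m + m. \<Sum>j<m + m. cs i * cs j * B (ts i) (ts j))
      = (\<Sum>i<m + m. cs i * (\<Sum>j<m + m. cs j * B (ts i) (ts j)))"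
    unfolding sum_distrib_left mult.assoc ..
  also have "\<dots> = (\<Sum>k<m. t k * ((\<Sum>l<m. t l * (B (F k) (F l) - B (F k) (G l)))
      - (\<Sum>l<m. t l * (B (G k) (F l) - B (G k) (G l)))))"
  proof -
    \<comment> \<open>Bilinearity: \<open>split2\<close> is applied once in each argument of the
      covariance.\<close>
    have "(\<Sum>j<m + m. cs j * B s (ts j)) = (\<Sum>l<m. t l * (B s (F l) - B s (G l)))" for s
      by (rule split2)
    then show ?thesis
      by (simp only: split2[of "\<lambda>s. \<Sum>l<m. t l * (B s (F l) - B s (G l))"])
  qed
  also have "\<dots> = (\<Sum>k<m. \<Sum>l<m. t k * t l * ((if k = l then p k else 0) - p k * p l))"
    unfolding sum_subtractf[symmetric] sum_distrib_left
  proof (intro sum.cong refl)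
    fix k l
    have cov: "B (F k) (F l) - B (F k) (G l) - B (G k) (F l) + B (G k) (G l)
        = (if k = l then p k else 0) - p k * p l"
      unfolding B_def F_def G_def by (rule bridge_cov_increment[OF p])
    show "t k * (t l * (B (F k) (F l) - B (F k) (G l)) - t l * (B (G k) (F l) - B (G k) (G l)))
        = t k * t l * ((if k = l then p k else 0) - p k * p l)"
      unfolding cov[symmetric] by (simp add: algebra_simps)
  qed
  also have "\<dots> = (\<Sum>k<m. (t k)\<^sup>2 * p k) - (\<Sum>k<m. t k * p k) * (\<Sum>l<m. t l * p l)"
    unfolding sum_product sum_subtractf[symmetric]
  proof (rule sum.cong[OF refl])
    fix k assume k: "k \<in> {..<m}"
    have "(\<Sum>l<m. t k * t l * ((if k = l then p k else 0) - p k * p l))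
        = (\<Sum>l<m. (if k = l then t k * t k * p k else 0) - t k * p k * (t l * p l))"
      by (rule sum.cong) (auto simp: algebra_simps)
    also have "\<dots> = (t k)\<^sup>2 * p k - (\<Sum>l<m. t k * p k * (t l * p l))"
      using k by (simp add: sum_subtractf power2_eq_square)
    finally show "(\<Sum>l<m. t k * t l * ((if k = l then p k else 0) - p k * p l))
        = (t k)\<^sup>2 * p k - (\<Sum>l<m. t k * p k * (t l * p l))" .
  qed
  also have "\<dots> = multinomial_var p d t"
    unfolding multinomial_var_def m_def lessThan_Suc_atMost power2_eq_square ..
  finally have v: "(\<Sum>i<m + m. \<Sum>j<m + m. cs i * cs j * (min (ts i) (ts j) - ts i * ts j)) = multinomial_var p d t"
    by (simp add: B_def)
  have "\<forall>i<m + m. ts i \<in> {0..1}" using ts01 by blast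
  then have "let v = (\<Sum>i<m + m. \<Sum>j<m + m. cs i * cs j * (min (ts i) (ts j) - ts i * ts j));
             Y = (\<lambda>\<omega>. \<Sum>i<m + m. cs i * U \<omega> (ts i))
         in (v = 0 \<longrightarrow> (AE \<omega> in N. Y \<omega> = 0)) \<and>
            (v > 0 \<longrightarrow> distributed N lborel Y (\<lambda>x. ennreal (normal_density 0 (sqrt v) x)))"
    using bb unfolding brownian_bridge_def by blast
  then show "multinomial_var p d t = 0 \<Longrightarrow> AE \<omega> in N. dot_upto d t (bridge_vec p d (U \<omega>)) = 0"
    and "multinomial_var p d t > 0 \<Longrightarrow> distributed N lborel (\<lambda>\<omega>. dot_upto d t (bridge_vec p d (U \<omega>)))
      (\<lambda>x. ennreal (normal_density 0 (sqrt (multinomial_var p d t)) x))"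
    unfolding v Y Let_def by blast+
qed

lemma bridge_vec_measurable:
  assumes bb: "brownian_bridge N U" and p: "\<And>j. 0 \<le> p j" and F1: "\<And>k. (\<Sum>j\<le>k. p j) \<le> 1"
  shows "(\<lambda>\<omega>. bridge_vec p d (U \<omega>)) \<in> borel_measurable N"
proof (rule measurable_coordinatewise_then_product)
  fix k
  have "(\<Sum>j<k. p j) \<le> (\<Sum>j\<le>k. p j)" using p by (intro sum_mono2) auto
  then have "(\<Sum>j\<le>k. p j) \<in> {0..1}" "(\<Sum>j<k. p j) \<in> {0..1}"
    using p F1[of k] by (auto simp: sum_nonneg)
  then have "(\<lambda>\<omega>. U \<omega> (\<Sum>j\<le>k. p j)) \<in> borel_measurable N" "(\<lambda>\<omega>. U \<omega> (\<Sum>j<k. p j)) \<in> borel_measurable N"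
    using bb unfolding brownian_bridge_def by blast+
  then show "(\<lambda>\<omega>. bridge_vec p d (U \<omega>) k) \<in> borel_measurable N"
    unfolding bridge_vec_def bb_incr_def by simp
qed

text \<open>Brings the limit into the standard normal form in which the univariate central limit
  theorem is stated.\<close>

lemma expectation_normal_scale:
  fixes f :: "real \<Rightarrow> real"
  assumes "prob_space N" and Y: "distributed N lborel Y (\<lambda>x. ennreal (normal_density 0 \<sigma> x))"
    and "0 < \<sigma>" and f: "f \<in> borel_measurable borel"
  shows "(\<integral>\<omega>. f (Y \<omega>) \<partial>N) = (\<integral>x. f (\<sigma> * x) \<partial>std_normal_distribution)"
proof -
  interpret prob_space N by fact
  have std: "distributed N lborel (\<lambda>\<omega>. Y \<omega> / \<sigma>) (\<lambda>x. ennreal (std_normal_density x))"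
    using Y normal_standard_normal_convert[OF \<open>0 < \<sigma>\<close>, of Y 0] by simp
  have [measurable]: "(\<lambda>\<omega>. Y \<omega> / \<sigma>) \<in> borel_measurable N" "f \<in> borel_measurable borel"
    using distributed_measurable[OF std] f by auto
  have "(\<integral>\<omega>. f (Y \<omega>) \<partial>N) = (\<integral>\<omega>. f (\<sigma> * (Y \<omega> / \<sigma>)) \<partial>N)"
    using \<open>0 < \<sigma>\<close> by simp
  also have "\<dots> = (\<integral>x. f (\<sigma> * x) \<partial>distr N lborel (\<lambda>\<omega>. Y \<omega> / \<sigma>))"
    by (subst integral_distr) auto
  also have "distr N lborel (\<lambda>\<omega>. Y \<omega> / \<sigma>) = std_normal_distribution"
    using std by (simp add: distributed_distr_eq_density)
  finally show ?thesis .
qed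

text \<open>Here \<open>d\<close> is merely an upper bound for the support, so one sample can be
  viewed with different values of \<open>d\<close>.\<close>

locale iid_pmf = prob_space M for M :: "'a measure" +
  fixes X :: "nat \<Rightarrow> 'a \<Rightarrow> nat" and p :: "nat \<Rightarrow> real" and d :: nat
  assumes indep: "indep_vars (\<lambda>_. count_space UNIV) X UNIV"
    and prob_X: "\<And>i j. prob {\<omega>\<in>space M. X i \<omega> = j} = p j"
    and p_zero: "\<And>j. j > d \<Longrightarrow> p j = 0"
begin

lemma p_nonneg: "0 \<le> p j"
  using prob_X[of 0 j] measure_nonneg by metis

lemma X_measurable [measurable]: "X i \<in> measurable M (count_space UNIV)"
  using indep unfolding indep_vars_def by simp

lemma AE_X_neq:
  assumes "p j = 0"
  shows "AE \<omega> in M. X i \<omega> \<noteq> j"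
proof -
  have "emeasure M {\<omega>\<in>space M. X i \<omega> = j} = 0"
    using assms prob_X[of i j] by (simp add: emeasure_eq_measure)
  then show ?thesis by (subst AE_iff_measurable[OF _ refl]) auto
qed

lemma AE_X_le: "AE \<omega> in M. \<forall>i. X i \<omega> \<le> d"
proof -
  have "AE \<omega> in M. X i \<omega> \<le> d" for i
  proof -
    have "AE \<omega> in M. \<forall>j\<in>{d<..}. X i \<omega> \<noteq> j"
      using AE_X_neq p_zero by (intro AE_ball_countable[THEN iffD2]) auto
    then show ?thesis by (rule eventually_mono) force
  qed
  then show ?thesis by (simp add: AE_all_countable)
qed

lemma expectation_X: "expectation (\<lambda>\<omega>. h (X i \<omega>)) = (\<Sum>k\<le>d. h k * p k)"
proof -
  have "expectation (\<lambda>\<omega>. h (X i \<omega>)) =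
      expectation (\<lambda>\<omega>. \<Sum>k\<le>d. h k * indicator {\<omega>\<in>space M. X i \<omega> = k} \<omega>)"
  proof (rule integral_cong_AE)
    show "AE \<omega> in M. h (X i \<omega>) = (\<Sum>k\<le>d. h k * indicator {\<omega>\<in>space M. X i \<omega> = k} \<omega>)"
      using AE_X_le AE_space
    proof eventually_elim
      case (elim \<omega>)
      then have "(\<Sum>k\<le>d. h k * indicator {\<omega>\<in>space M. X i \<omega> = k} \<omega>) = (\<Sum>k\<le>d. if k = X i \<omega> then h k else 0)"
        by (intro sum.cong) auto
      then show ?case using elim by simp
    qed
  qed auto
  also have "\<dots> = (\<Sum>k\<le>d. h k * p k)"
  proof -
    have "integrable M (indicator {\<omega>\<in>space M. X i \<omega> = k} :: 'a \<Rightarrow> real)" for k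
      by (rule integrable_bounded[of _ 1]) (auto simp: indicator_def)
    then show ?thesis
      by (subst Bochner_Integration.integral_sum) (simp_all add: prob_X)
  qed
  finally show ?thesis .
qed

lemma sum_p: "(\<Sum>k\<le>d. p k) = 1"
  using expectation_X[of "\<lambda>_. 1" 0] prob_space by simp

lemma sum_p_le_1: "(\<Sum>k\<le>l. p k) \<le> 1"
proof -
  have "(\<Sum>k\<le>l. p k) \<le> (\<Sum>k\<le>max l d. p k)" using p_nonneg by (intro sum_mono2) auto
  also have "\<dots> = (\<Sum>k\<le>d. p k)" using p_zero by (intro sum.mono_neutral_right) auto
  finally show ?thesis by (simp add: sum_p)
qed

lemma distr_X: "distr M (count_space UNIV) (X i) = distr M (count_space UNIV) (X 0)"
proof (rule measure_eqI_countable[of _ UNIV])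
  fix a :: nat
  have "X i -` {a} \<inter> space M = {\<omega>\<in>space M. X i \<omega> = a}" for i by auto
  then show "emeasure (distr M (count_space UNIV) (X i)) {a} = emeasure (distr M (count_space UNIV) (X 0)) {a}"
    by (simp add: emeasure_distr emeasure_eq_measure prob_X)
qed auto

text \<open>Exchanging the sums over values and over observations turns a linear form of the
  frequencies into a normalised sum of i.i.d. variables.\<close>

lemma dot_upto_scaled_emp:
  assumes "0 < n"
  shows "dot_upto d t (scaled_emp p d X n \<omega>) =
    (\<Sum>i<n. (if X i \<omega> \<le> d then t (X i \<omega>) else 0) - (\<Sum>k\<le>d. t k * p k)) / sqrt (real n)"
proof -
  define a where "a j = (if j \<le> d then t j else 0)" for j
  define \<mu> where "\<mu> = (\<Sum>k\<le>d. t k * p k)"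
  have card: "real (card {i. i < n \<and> X i \<omega> = k}) = (\<Sum>i<n. if X i \<omega> = k then 1 else 0)" for k
  proof -
    have "{i. i < n \<and> X i \<omega> = k} = {..<n} \<inter> {i. X i \<omega> = k}" by auto
    then show ?thesis by (simp add: sum.If_cases)
  qed
  have "(\<Sum>k\<le>d. t k * real (card {i. i < n \<and> X i \<omega> = k})) = (\<Sum>i<n. \<Sum>k\<le>d. t k * (if X i \<omega> = k then 1 else 0))"
    unfolding card sum_distrib_left by (rule sum.swap)
  also have "\<dots> = (\<Sum>i<n. a (X i \<omega>))"
    by (rule sum.cong) (auto simp: a_def if_distrib[of "\<lambda>c. _ * c"] cong: if_cong)
  finally have S: "(\<Sum>k\<le>d. t k * real (card {i. i < n \<and> X i \<omega> = k})) = (\<Sum>i<n. a (X i \<omega>))" .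
  have "dot_upto d t (scaled_emp p d X n \<omega>) =
      (\<Sum>k\<le>d. sqrt n / n * (t k * real (card {i. i < n \<and> X i \<omega> = k})) - sqrt n * (t k * p k))"
    unfolding dot_upto_def scaled_emp_def emp_pmf_def by (rule sum.cong) (auto simp: algebra_simps)
  also have "\<dots> = sqrt n / n * (\<Sum>i<n. a (X i \<omega>)) - sqrt n * \<mu>"
    unfolding S[symmetric] \<mu>_def sum_distrib_left sum_subtractf ..
  also have "\<dots> = ((\<Sum>i<n. a (X i \<omega>)) - n * \<mu>) / sqrt n"
    using assms by (simp add: field_simps real_div_sqrt)
  finally show ?thesis by (simp add: a_def \<mu>_def sum_subtractf)
qed

lemma linear_form_moments:
  fixes t :: "nat \<Rightarrow> real"
  defines "Z \<equiv> \<lambda>i \<omega>. if X i \<omega> \<le> d then t (X i \<omega>) else 0"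
  shows "expectation (Z i) = (\<Sum>k\<le>d. t k * p k)"
    and "integrable M (\<lambda>\<omega>. (Z i \<omega>)\<^sup>2)"
    and "variance (Z i) = multinomial_var p d t"
    and "expectation (\<lambda>\<omega>. (Z i \<omega> - (\<Sum>k\<le>d. t k * p k))\<^sup>2) = multinomial_var p d t"
proof -
  define a where "a j = (if j \<le> d then t j else 0)" for j
  have Z: "Z i = (\<lambda>\<omega>. a (X i \<omega>))" by (auto simp: Z_def a_def)
  show E: "expectation (Z i) = (\<Sum>k\<le>d. t k * p k)"
    unfolding Z expectation_X by (simp add: a_def)
  have E2: "expectation (\<lambda>\<omega>. (Z i \<omega>)\<^sup>2) = (\<Sum>k\<le>d. (t k)\<^sup>2 * p k)"
    unfolding Z expectation_X[of "\<lambda>x. (a x)\<^sup>2"] by (simp add: a_def)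
  have bd: "\<bar>a j\<bar> \<le> (\<Sum>k\<le>d. \<bar>t k\<bar>)" for j
    by (auto simp: a_def intro: member_le_sum sum_nonneg)
  have int: "integrable M (Z i)"
    unfolding Z using bd by (intro integrable_bounded) auto
  show int2: "integrable M (\<lambda>\<omega>. (Z i \<omega>)\<^sup>2)"
    unfolding Z using bd by (intro integrable_bounded[of _ "(\<Sum>k\<le>d. \<bar>t k\<bar>)\<^sup>2"]) (auto simp: abs_le_square_iff[symmetric])
  show "variance (Z i) = multinomial_var p d t"
    using variance_eq[OF int int2] by (simp add: E E2 multinomial_var_def)
  then show "expectation (\<lambda>\<omega>. (Z i \<omega> - (\<Sum>k\<le>d. t k * p k))\<^sup>2) = multinomial_var p d t"
    by (simp only: E)
qed

text \<open>The central limit theorem needs positive variance. Variance zero does occur, for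
  instance for constant \<open>t\<close>, since the probabilities sum to 1; then both linear forms
  are almost surely zero (for n > 0).\<close>

lemma scaled_emp_linear_weak_conv:
  assumes bb: "brownian_bridge N U"
  shows "linear_weak_conv d M (scaled_emp p d X) N (\<lambda>\<omega>. bridge_vec p d (U \<omega>))"
  unfolding linear_weak_conv_def weak_conv_rv_def
proof (intro allI impI)
  fix t and f :: "real \<Rightarrow> real"
  assume f: "continuous_on UNIV f \<and> bounded (range f)"
  then obtain C where C: "\<And>x. \<bar>f x\<bar> \<le> C" by (auto simp: bounded_iff)
  have fm [measurable]: "f \<in> borel_measurable borel"
    using f by (intro borel_measurable_continuous_onI) auto
  interpret N: prob_space N using bb by (simp add: brownian_bridge_def)
  define v where "v = multinomial_var p d t"
  define \<mu> where "\<mu> = (\<Sum>k\<le>d. t k * p k)"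
  define Z where "Z i \<omega> = (if X i \<omega> \<le> d then t (X i \<omega>) else 0)" for i \<omega>
  have Zm [measurable]: "Z i \<in> borel_measurable M" for i unfolding Z_def by measurable
  have var: "expectation (Z i) = \<mu>" "integrable M (\<lambda>\<omega>. (Z i \<omega>)\<^sup>2)" "variance (Z i) = v"
    "expectation (\<lambda>\<omega>. (Z i \<omega> - \<mu>)\<^sup>2) = v" for i
    using linear_form_moments[of i t] unfolding Z_def[symmetric] \<mu>_def[symmetric] v_def by auto
  have ipZ: "dot_upto d t (scaled_emp p d X n \<omega>) = (\<Sum>i<n. Z i \<omega> - \<mu>) / sqrt (real n)" if "0 < n" for n \<omega>
    using dot_upto_scaled_emp[OF that] unfolding Z_def \<mu>_def .
  note normal = bridge_vec_normal[OF bb p_nonneg sum_p_le_1, of d t, folded v_def]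
  have bm [measurable]: "(\<lambda>\<omega>. dot_upto d t (bridge_vec p d (U \<omega>))) \<in> borel_measurable N"
    by (rule borel_measurable_continuous_fun[OF continuous_on_dot_upto bridge_vec_measurable[OF bb p_nonneg sum_p_le_1]])
  have "0 \<le> v" unfolding var(4)[symmetric, of 0] by (intro integral_nonneg_AE) auto
  then consider "v = 0" | "0 < v" by linarith
  then show "(\<lambda>n. \<integral>\<omega>. f (dot_upto d t (scaled_emp p d X n \<omega>)) \<partial>M)
      \<longlonglongrightarrow> (\<integral>\<omega>. f (dot_upto d t (bridge_vec p d (U \<omega>))) \<partial>N)"
  proof cases
    case 1
    have int: "integrable M (\<lambda>\<omega>. (Z i \<omega> - \<mu>)\<^sup>2)" for i
    proof -
      have "integrable M (Z i)" using var(2) by (rule square_integrable_imp_integrable[rotated]) simp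
      then show ?thesis using var(2) by (simp add: power2_diff)
    qed
    have "AE \<omega> in M. Z i \<omega> = \<mu>" for i
      using integral_nonneg_eq_0_iff_AE[OF int, of i] var(4)[of i] 1 by simp
    then have AE0: "AE \<omega> in M. \<forall>i. Z i \<omega> = \<mu>" by (simp add: AE_all_countable)
    have "(\<integral>\<omega>. f (dot_upto d t (scaled_emp p d X n \<omega>)) \<partial>M) = f 0" if "0 < n" for n
    proof -
      have "(\<integral>\<omega>. f (dot_upto d t (scaled_emp p d X n \<omega>)) \<partial>M) = (\<integral>\<omega>. f 0 \<partial>M)"
        unfolding ipZ[OF that] by (rule integral_cong_AE) (use AE0 in auto)
      then show ?thesis by (simp add: prob_space)
    qed
    then have "eventually (\<lambda>n. (\<integral>\<omega>. f (dot_upto d t (scaled_emp p d X n \<omega>)) \<partial>M) = f 0) sequentially"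
      by (rule eventually_mono[OF eventually_gt_at_top[of 0]])
    moreover have "(\<integral>\<omega>. f (dot_upto d t (bridge_vec p d (U \<omega>))) \<partial>N) = f 0"
    proof -
      have "(\<integral>\<omega>. f (dot_upto d t (bridge_vec p d (U \<omega>))) \<partial>N) = (\<integral>\<omega>. f 0 \<partial>N)"
        by (rule integral_cong_AE) (use normal(1)[OF 1] in auto)
      then show ?thesis by (simp add: N.prob_space)
    qed
    ultimately show ?thesis by (simp add: tendsto_eventually)
  next
    case 2
    define \<sigma> where "\<sigma> = sqrt v"
    have \<sigma>: "0 < \<sigma>" "\<sigma>\<^sup>2 = v" using 2 by (auto simp: \<sigma>_def)
    have distr: "distr M borel (Z i) = distr M borel (Z 0)" for i
    proof -
      have "distr M borel (Z i) = distr (distr M (count_space UNIV) (X i)) borel (\<lambda>j. if j \<le> d then t j else 0)" for i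
        by (subst distr_distr) (auto simp: comp_def Z_def[abs_def])
      then show ?thesis using distr_X by metis
    qed
    have indZ: "indep_vars (\<lambda>_. borel) Z UNIV"
      unfolding Z_def[abs_def] by (rule indep_vars_compose2[OF indep]) auto
    have clt: "weak_conv_m (\<lambda>n. distr M borel (\<lambda>\<omega>. (\<Sum>i<n. Z i \<omega> - \<mu>) / sqrt (n * \<sigma>\<^sup>2))) std_normal_distribution"
      by (rule central_limit_theorem[OF indZ var(1) \<sigma>(1) var(2) _ distr]) (simp add: var(3) \<sigma>(2))
    \<comment> \<open>The theorem divides by the standard deviation; the test function f (\<sigma> *
      x) undoes this.\<close>
    have "(\<lambda>n. \<integral>x. f (\<sigma> * x) \<partial>distr M borel (\<lambda>\<omega>. (\<Sum>i<n. Z i \<omega> - \<mu>) / sqrt (n * \<sigma>\<^sup>2)))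
        \<longlonglongrightarrow> (\<integral>x. f (\<sigma> * x) \<partial>std_normal_distribution)"
    proof (rule weak_conv_imp_integral_bdd_continuous_conv[OF _ _ clt])
      show "real_distribution (distr M borel (\<lambda>\<omega>. (\<Sum>i<n. Z i \<omega> - \<mu>) / sqrt (n * \<sigma>\<^sup>2)))" for n
        by (rule real_distribution_distr) measurable
      have "continuous_on UNIV (\<lambda>x. f (\<sigma> * x))"
        using f by (auto intro!: continuous_on_compose2[of UNIV f] continuous_intros)
      then show "isCont (\<lambda>x. f (\<sigma> * x)) x" for x
        by (simp add: continuous_on_eq_continuous_at)
      show "norm (f (\<sigma> * x)) \<le> C" for x using C by simp
    qed (rule real_dist_normal_dist)
    also have "(\<integral>x. f (\<sigma> * x) \<partial>std_normal_distribution) = (\<integral>\<omega>. f (dot_upto d t (bridge_vec p d (U \<omega>))) \<partial>N)"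
      using normal(2)[OF 2] \<sigma>(1) unfolding \<sigma>_def
      by (intro expectation_normal_scale[OF N.prob_space_axioms, symmetric]) auto
    finally have lim: "(\<lambda>n. \<integral>x. f (\<sigma> * x) \<partial>distr M borel (\<lambda>\<omega>. (\<Sum>i<n. Z i \<omega> - \<mu>) / sqrt (n * \<sigma>\<^sup>2)))
        \<longlonglongrightarrow> (\<integral>\<omega>. f (dot_upto d t (bridge_vec p d (U \<omega>))) \<partial>N)" .
    have "(\<integral>x. f (\<sigma> * x) \<partial>distr M borel (\<lambda>\<omega>. (\<Sum>i<n. Z i \<omega> - \<mu>) / sqrt (n * \<sigma>\<^sup>2)))
        = (\<integral>\<omega>. f (dot_upto d t (scaled_emp p d X n \<omega>)) \<partial>M)" if "0 < n" for n
    proof -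
      have "\<sigma> * (y / sqrt (n * \<sigma>\<^sup>2)) = y / sqrt n" for y
        using \<sigma>(1) by (simp add: real_sqrt_mult)
      then show ?thesis by (subst integral_distr) (simp_all add: ipZ[OF that])
    qed
    then have "eventually (\<lambda>n. (\<integral>x. f (\<sigma> * x) \<partial>distr M borel (\<lambda>\<omega>. (\<Sum>i<n. Z i \<omega> - \<mu>) / sqrt (n * \<sigma>\<^sup>2)))
        = (\<integral>\<omega>. f (dot_upto d t (scaled_emp p d X n \<omega>)) \<partial>M)) sequentially"
      by (rule eventually_mono[OF eventually_gt_at_top[of 0]])
    then show ?thesis using lim by (rule Lim_transform_eventually[rotated])
  qed
qed

end

subsection \<open>Weak convergence of the estimator\<close>

lemma emp_pmf_depends_on_list:
  "emp_pmf X n \<omega> = (\<lambda>k. real (length (filter ((=) k) (map (\<lambda>i. X i \<omega>) [0..<n]))) / real n)"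
proof
  fix k
  have "card {i. i < n \<and> X i \<omega> = k} = length (filter ((=) k) (map (\<lambda>i. X i \<omega>) [0..<n]))"
    unfolding length_filter_conv_card by (rule arg_cong[of _ _ card]) auto
  then show "emp_pmf X n \<omega> k = real (length (filter ((=) k) (map (\<lambda>i. X i \<omega>) [0..<n]))) / real n"
    by (simp add: emp_pmf_def)
qed

text \<open>Lists of naturals form a countable type, so it suffices that appending the next
  observation is measurable for each fixed list of earlier ones.\<close>

lemma (in iid_pmf) measurable_observations:
  "(\<lambda>\<omega>. map (\<lambda>i. X i \<omega>) [0..<n]) \<in> measurable M (count_space UNIV)"
proof (induction n)
  case (Suc n)
  have "(\<lambda>\<omega>. l @ [X n \<omega>]) \<in> measurable M (count_space UNIV)" for l
    using X_measurable[of n] by (rule measurable_compose) simp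
  from measurable_compose_countable[OF this Suc.IH]
  show ?case by simp
qed simp

text \<open>The observations range over a countable set, so \<open>G\<close> may be arbitrary; this spares a proof
  that \<open>lse\<close> is measurable.\<close>

lemma (in iid_pmf) measurable_emp_pmf:
  fixes G :: "(nat \<Rightarrow> real) \<Rightarrow> real"
  shows "(\<lambda>\<omega>. G (emp_pmf X n \<omega>)) \<in> borel_measurable M"
proof -
  define g where "g l = G (\<lambda>k. real (length (filter ((=) k) l)) / real n)" for l
  have "g \<in> borel_measurable (count_space UNIV)" by simp
  with measurable_observations have "(\<lambda>\<omega>. g (map (\<lambda>i. X i \<omega>) [0..<n])) \<in> borel_measurable M"
    by (rule measurable_compose)
  then show ?thesis unfolding g_def emp_pmf_depends_on_list .
qed

lemma cdfF_scale: "cdfF (\<lambda>k. c * g k) = (\<lambda>x. c * cdfF g x)"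
  by (rule ext) (simp add: cdfF_def sum_distrib_left)

lemma cdfH_scale: "cdfH (\<lambda>k. c * g k) = (\<lambda>x. c * cdfH g x)"
  by (rule ext) (simp add: cdfH_def cdfF_scale sum_distrib_left)

lemma cdfF_diff: "cdfF p x - cdfF q x = cdfF (\<lambda>k. p k - q k) x"
  by (simp add: cdfF_def sum_subtractf)

lemma cdfH_diff: "cdfH p x - cdfH q x = cdfH (\<lambda>k. p k - q k) x"
  by (simp add: cdfH_def cdfF_diff[symmetric] sum_subtractf)

text \<open>The three components are linear in \<open>g\<close>, so the three scaled differences of
  the theorem are this one map applied to the scaled error of the estimator.\<close>

definition summaries :: "nat \<Rightarrow> (nat \<Rightarrow> real) \<Rightarrow> (nat \<Rightarrow> real) \<times> (nat \<Rightarrow> real) \<times> (nat \<Rightarrow> real)" where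
  "summaries S g = (restr S (cdfH g), restr S (cdfF g), restr S g)"

lemma continuous_on_summaries: "continuous_on UNIV (summaries S)"
proof -
  have "continuous_on UNIV (\<lambda>g::nat\<Rightarrow>real. restr S (cdfH g) x)"
    "continuous_on UNIV (\<lambda>g::nat\<Rightarrow>real. restr S (cdfF g) x)"
    "continuous_on UNIV (\<lambda>g::nat\<Rightarrow>real. restr S g x)" for x
    unfolding restr_def cdfH_def cdfF_def by (cases "x \<le> S + 1"; auto intro!: continuous_intros)+
  then show ?thesis
    unfolding summaries_def
    by (intro continuous_on_Pair continuous_on_coordinatewise_then_product)
qed

theorem theorem3:
  fixes M :: "'a measure" and X :: "nat \<Rightarrow> 'a \<Rightarrow> nat"
    and N :: "'b measure" and U :: "'b \<Rightarrow> real \<Rightarrow> real"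
    and p0 :: "nat \<Rightarrow> real" and S :: nat
  assumes "prob_space M"
    and "convex_pmf_support p0 S"
    and "prob_space.indep_vars M (\<lambda>_. count_space UNIV) X UNIV"
    and "\<And>i j. measure M {\<omega>\<in>space M. X i \<omega> = j} = p0 j"
    and "brownian_bridge N U"
  shows "weak_conv_rv M
     (\<lambda>n \<omega>. let ph = lse (emp_pmf X n \<omega>) in
        (restr S (\<lambda>x. sqrt (real n) * (cdfH ph x - cdfH p0 x)),
         restr S (\<lambda>x. sqrt (real n) * (cdfF ph x - cdfF p0 x)),
         restr S (\<lambda>x. sqrt (real n) * (ph x - p0 x))))
     N
     (\<lambda>\<omega>. let g = ghat p0 S (U \<omega>) in
        (restr S (cdfH g), restr S (cdfF g), restr S g))"
proof -
  define d where "d = S + 1"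
  have p00: "p0 k = 0" if "k > S" for k
    using assms(2) that by (simp add: convex_pmf_support_def)
  \<comment> \<open>Two views of the same sample: the bound S makes the empirical pmf vanish beyond
    S almost surely, and the bound S + 1 gives the limit theorem in the dimension of the
    cone.\<close>
  interpret X: iid_pmf M X p0 S
    using assms(1,3,4) p00 by (simp add: iid_pmf_def iid_pmf_axioms_def)
  interpret Xd: iid_pmf M X p0 d
    using assms(1,3,4) p00 by (simp add: iid_pmf_def iid_pmf_axioms_def d_def)
  have prob_N: "prob_space N" using assms(5) by (simp add: brownian_bridge_def)
  define A where "A = nonknots p0 S"
  define \<Psi> where "\<Psi> v = summaries S (cone_proj A d v)" for v
  define W where "W = scaled_emp p0 d X"
  define Y where "Y \<omega> = bridge_vec p0 d (U \<omega>)" for \<omega>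
  define R where "R n \<omega> = summaries S (\<lambda>k. sqrt (real n) * (lse (emp_pmf X n \<omega>) k - p0 k))" for n \<omega>
  have \<Psi>: "continuous_on UNIV \<Psi>"
    unfolding \<Psi>_def using continuous_on_summaries continuous_on_cone_proj
    by (rule continuous_on_compose2) simp
  have limit: "\<Psi> (Y \<omega>) = summaries S (ghat p0 S (U \<omega>))" for \<omega>
    unfolding \<Psi>_def ghat_eq_cone_proj A_def d_def[symmetric]
    by (subst cone_proj_cong[of d "Y \<omega>" "bb_incr p0 (U \<omega>)"]) (auto simp: Y_def bridge_vec_def)
  have Wm: "W n \<in> borel_measurable M" for n
  proof (rule measurable_coordinatewise_then_product)
    fix k
    show "(\<lambda>\<omega>. W n \<omega> k) \<in> borel_measurable M"
      unfolding W_def scaled_emp_def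
      by (rule X.measurable_emp_pmf[of "\<lambda>q. if k \<le> d then sqrt (real n) * (q k - p0 k) else 0" n])
  qed
  have Ym: "Y \<in> borel_measurable N"
    unfolding Y_def using assms(5) X.p_nonneg X.sum_p_le_1 by (rule bridge_vec_measurable)
  have lin: "linear_weak_conv d M W N Y"
    unfolding W_def Y_def using assms(5) by (rule Xd.scaled_emp_linear_weak_conv)
  have conv: "weak_conv_rv M W N Y"
    using assms(1) prob_N Wm Ym _ _ lin
    by (rule cramer_wold) (auto simp: W_def scaled_emp_def Y_def bridge_vec_def)
  obtain \<delta> where \<delta>: "0 < \<delta>" "\<And>k. k \<in> {1..S+1} \<Longrightarrow> is_knot p0 k \<Longrightarrow> \<delta> \<le> Delta p0 k"
    using min_knot_jump by blast
  \<comment> \<open>If every coordinate of the empirical error is at most \<open>c\<close>,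
    \<open>sqrt_sqdist_le\<close> bounds its norm by a quarter of \<delta>, as
    \<open>lse_eq_cone_proj\<close> demands.\<close>
  define c where "c = \<delta> / (4 * (real d + 1))"
  have c: "0 < c" using \<delta>(1) by (simp add: c_def)
  have R_eq: "R n \<omega> = \<Psi> (W n \<omega>)"
    if n: "0 < n" and le: "\<forall>i. X i \<omega> \<le> S" and small: "\<And>k. k \<le> d \<Longrightarrow> \<bar>W n \<omega> k\<bar> \<le> sqrt n * c" for n \<omega>
  proof -
    define q where "q = emp_pmf X n \<omega>"
    have q0: "q k = 0" if "k > S" for k
    proof -
      have "X i \<omega> \<noteq> k" for i using le[rule_format, of i] that by auto
      then show ?thesis by (simp add: q_def emp_pmf_def)
    qed
    have "\<bar>q k - p0 k\<bar> \<le> c" if "k \<le> d" for k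
      using small[OF that] that n by (simp add: W_def scaled_emp_def q_def abs_mult)
    then have "4 * sqrt (sqdist_upto (S + 1) q p0) \<le> 4 * ((real d + 1) * c)"
      unfolding d_def[symmetric] using c by (intro mult_left_mono sqrt_sqdist_le) auto
    also have "\<dots> = \<delta>"
    proof -
      have "real d + 1 \<noteq> 0" by linarith
      then show ?thesis unfolding c_def by (auto simp: divide_simps)
    qed
    finally have near: "4 * sqrt (sqdist_upto (S + 1) q p0) \<le> \<delta>" .
    have "lse q = (\<lambda>k. p0 k + cone_proj A d (\<lambda>k. q k - p0 k) k)"
      unfolding A_def d_def by (rule lse_eq_cone_proj[OF assms(2) \<delta>(2) q0 near])
    then have "(\<lambda>k. sqrt (real n) * (lse q k - p0 k)) = cone_proj A d (\<lambda>k. sqrt (real n) * (q k - p0 k))"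
      by (simp add: cone_proj_scale)
    also have "\<dots> = cone_proj A d (W n \<omega>)"
      by (rule cone_proj_cong) (simp add: W_def scaled_emp_def q_def)
    finally show ?thesis by (simp add: R_def \<Psi>_def q_def)
  qed
  have "(\<lambda>n. \<integral>\<omega>. f (R n \<omega>) \<partial>M) \<longlonglongrightarrow> (\<integral>\<omega>. f (\<Psi> (Y \<omega>)) \<partial>N)"
    if f: "continuous_on UNIV f" and "bounded (range f)"
    for f :: "(nat \<Rightarrow> real) \<times> (nat \<Rightarrow> real) \<times> (nat \<Rightarrow> real) \<Rightarrow> real"
  proof -
    obtain C where C: "\<And>x. \<bar>f x\<bar> \<le> C" using \<open>bounded (range f)\<close> by (auto simp: bounded_iff)
    then have C0: "0 \<le> C" using abs_ge_zero order_trans by blast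
    have f\<Psi>: "continuous_on UNIV (\<lambda>v. f (\<Psi> v))"
      using f \<Psi> by (rule continuous_on_compose2) simp
    have "bounded (range (\<lambda>v. f (\<Psi> v)))" by (rule boundedI[of _ C]) (metis C imageE real_norm_def)
    then have lim: "(\<lambda>n. \<integral>\<omega>. f (\<Psi> (W n \<omega>)) \<partial>M) \<longlonglongrightarrow> (\<integral>\<omega>. f (\<Psi> (Y \<omega>)) \<partial>N)"
      using conv f\<Psi> unfolding weak_conv_rv_def by blast
    have intR: "integrable M (\<lambda>\<omega>. f (R n \<omega>))" for n
      unfolding R_def
      by (rule X.integrable_bounded[OF X.measurable_emp_pmf
        [of "\<lambda>q. f (summaries S (\<lambda>k. sqrt (real n) * (lse q k - p0 k)))" n] C])
    have intW: "integrable M (\<lambda>\<omega>. f (\<Psi> (W n \<omega>)))" for n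
      using borel_measurable_continuous_fun[OF f\<Psi> Wm] C by (rule X.integrable_bounded)
    have intT: "integrable M (\<lambda>\<omega>. tail_fn d L (W n \<omega>))" for n L
      using borel_measurable_continuous_fun[OF continuous_on_tail_fn Wm]
      by (rule X.integrable_bounded[of _ "real d + 1"]) (simp add: tail_fn_nonneg tail_fn_le)
    \<comment> \<open>Almost surely the integrands can differ only if some coordinate of
      \<open>W\<close> exceeds sqrt n * c \<ge> L + 1; there the tail function is at least 1 and the
      difference at most 2 * C.\<close>
    have diff: "\<bar>(\<integral>\<omega>. f (R n \<omega>) \<partial>M) - (\<integral>\<omega>. f (\<Psi> (W n \<omega>)) \<partial>M)\<bar>
        \<le> 2 * C * (\<integral>\<omega>. tail_fn d L (W n \<omega>) \<partial>M)" if n: "0 < n" and L: "L + 1 \<le> sqrt n * c" for n L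
    proof -
      have "\<bar>(\<integral>\<omega>. f (R n \<omega>) \<partial>M) - (\<integral>\<omega>. f (\<Psi> (W n \<omega>)) \<partial>M)\<bar> = \<bar>\<integral>\<omega>. f (R n \<omega>) - f (\<Psi> (W n \<omega>)) \<partial>M\<bar>"
        using intR intW by simp
      also have "\<dots> \<le> (\<integral>\<omega>. \<bar>f (R n \<omega>) - f (\<Psi> (W n \<omega>))\<bar> \<partial>M)"
        by (rule integral_abs_bound)
      also have "\<dots> \<le> (\<integral>\<omega>. 2 * C * tail_fn d L (W n \<omega>) \<partial>M)"
      proof (rule integral_mono_AE)
        show "AE \<omega> in M. \<bar>f (R n \<omega>) - f (\<Psi> (W n \<omega>))\<bar> \<le> 2 * C * tail_fn d L (W n \<omega>)"
          using X.AE_X_le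
        proof eventually_elim
          case (elim \<omega>)
          show ?case
          proof (cases "\<forall>k\<le>d. \<bar>W n \<omega> k\<bar> \<le> sqrt n * c")
            case True
            then show ?thesis using R_eq[OF n elim] C0 by (simp add: tail_fn_nonneg)
          next
            case False
            then obtain k where "k \<le> d" "L + 1 \<le> \<bar>W n \<omega> k\<bar>" using L by force
            then have "2 * C * 1 \<le> 2 * C * tail_fn d L (W n \<omega>)"
              using C0 by (intro mult_left_mono tail_fn_ge_1) auto
            then show ?thesis using C[of "R n \<omega>"] C[of "\<Psi> (W n \<omega>)"] by linarith
          qed
        qed
      qed (use intR intW intT in auto)
      finally show ?thesis by simp
    qed
    have "(\<lambda>n. (\<integral>\<omega>. f (R n \<omega>) \<partial>M) - (\<integral>\<omega>. f (\<Psi> (W n \<omega>)) \<partial>M)) \<longlonglongrightarrow> 0"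
    proof (rule tendstoI)
      fix e :: real assume e: "0 < e"
      \<comment> \<open>The summand 1 keeps the divisor positive when C = 0.\<close>
      define D where "D = 2 * C + 1"
      have D: "0 < D" using C0 by (simp add: D_def)
      have "eventually (\<lambda>L. (\<integral>\<omega>. tail_fn d (real L) (Y \<omega>) \<partial>N) < e / D) sequentially"
        using e D by (intro order_tendstoD(2)[OF tail_fn_expectation_tendsto_0[OF prob_N Ym]]) simp
      then obtain L :: nat where L: "(\<integral>\<omega>. tail_fn d L (Y \<omega>) \<partial>N) < e / D"
        using eventually_happens'[OF sequentially_bot] by blast
      \<comment> \<open>The admissible radius for the scaled error grows like sqrt n, so it
        eventually contains the box of fixed radius L + 1.\<close>
      have "filterlim (\<lambda>n. sqrt (real n) * c) at_top sequentially"
        using filterlim_compose[OF sqrt_at_top filterlim_real_sequentially] c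
        by (intro filterlim_at_top_mult_tendsto_pos[OF tendsto_const]) auto
      then have "eventually (\<lambda>n. real L + 1 \<le> sqrt (real n) * c) sequentially"
        by (simp add: filterlim_at_top)
      moreover have "eventually (\<lambda>n. (\<integral>\<omega>. tail_fn d L (W n \<omega>) \<partial>M) < e / D) sequentially"
        using tail_fn_expectation_tendsto[OF assms(1) prob_N Wm Ym lin] L by (rule order_tendstoD)
      ultimately show "eventually (\<lambda>n. dist ((\<integral>\<omega>. f (R n \<omega>) \<partial>M) - (\<integral>\<omega>. f (\<Psi> (W n \<omega>)) \<partial>M)) 0 < e) sequentially"
        using eventually_gt_at_top[of 0]
      proof eventually_elim
        case (elim n)
        define T where "T = (\<integral>\<omega>. tail_fn d L (W n \<omega>) \<partial>M)"
        have "0 \<le> T" unfolding T_def by (intro integral_nonneg_AE) (simp add: tail_fn_nonneg)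
        then have "2 * C * T \<le> D * T" by (simp add: D_def mult_right_mono)
        also have "\<dots> < e" using elim(2) D by (simp add: T_def field_simps)
        finally show ?case using diff[OF elim(3,1)] by (simp add: T_def)
      qed
    qed
    from tendsto_add[OF this lim] show ?thesis by simp
  qed
  then have "weak_conv_rv M R N (\<lambda>\<omega>. \<Psi> (Y \<omega>))"
    unfolding weak_conv_rv_def by blast
  moreover have "R = (\<lambda>n \<omega>. let ph = lse (emp_pmf X n \<omega>) in
      (restr S (\<lambda>x. sqrt (real n) * (cdfH ph x - cdfH p0 x)),
       restr S (\<lambda>x. sqrt (real n) * (cdfF ph x - cdfF p0 x)),
       restr S (\<lambda>x. sqrt (real n) * (ph x - p0 x))))"
    unfolding R_def summaries_def Let_def cdfH_scale cdfF_scale cdfH_diff cdfF_diff ..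
  ultimately show ?thesis
    unfolding limit summaries_def Let_def by simp
qed

end
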